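(* Fix any integers $K\ge 2$ and $d\ge 1$. There exists a constant $C(d,K)>0$ (depending only on $d$ and $K$) such that for all $n\ge 1$ and every observable $\mathcal{A}\in M_K(\mathbb{C})^{\otimes n}$ of degree at most $d$ (in the Gell-Mann sense), $$\|\widehat{\mathcal{A}}\|_{\frac{2d}{d+1}}:=\Big(\sum_{\alpha\in\Lambda_K^n}|\widehat{\mathcal{A}}(\alpha)|^{\frac{2d}{d+1}}\Big)^{\frac{d+1}{2d}}\le C(d,K)\,\|\mathcal{A}\|_{\mathrm{op}}.$$ Moreover, $C(d,K)\le \big(\tfrac32(K^2-K)\big)^d\,\mathrm{BH}^{\le d}_{\{\pm1\}}$.
   Context: An observable is a Hermitian operator; $\|\cdot\|_{\mathrm{op}}$ is the operator norm. Gell-Mann basis: let $e_j=|j\rangle$, $1\le j\le K$, be the canonical basis of $\mathbb{C}^K$ and $E_{jk}=|j\rangle\langle k|$. The (generalized) Gell-Mann basis $\mathrm{GM}(K)$ of $M_K(\mathbb{C})$ consists of the identity $\mathbf{I}$ together with $\mathbf{A}_{jk}=\sqrt{K/2}\,(E_{jk}+E_{kj})$ and $\mathbf{B}_{jk}=\sqrt{K/2}\,(-iE_{jk}+iE_{kj})$ for $1\le j<k\le K$, and $\mathbf{C}_m=\Gamma_m\big(\sum_{k=1}^mE_{kk}-mE_{m+1,m+1}\big)$ for $1\le m\le K-1$, where $\Gamma_m=\sqrt{K/(m^2+m)}$. Write $\mathrm{GM}(K)=\{M_\alpha\}_{\alpha\in\Lambda_K}$ for an index set $\Lambda_K$. It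 is an orthonormal basis for the inner product $\frac1K\mathrm{tr}[A^\dagger B]$. Every $\mathcal{A}\in M_K(\mathbb{C})^{\otimes n}$ has a unique expansion $\mathcal{A}=\sum_{\alpha\in\Lambda_K^n}\widehat{\mathcal{A}}(\alpha)M_\alpha$ with $M_\alpha=\bigotimes_{j=1}^nM_{\alpha_j}$. Put $|\alpha|=|\{j:M_{\alpha_j}\ne\mathbf{I}\}|$; $\mathcal{A}$ has degree at most $d$ if $\widehat{\mathcal{A}}(\alpha)=0$ whenever $|\alpha|>d$. Boolean constant: a function $f$ on $\{-1,1\}^N$ has the expansion $f(x)=\sum_{A\subset[N]}\widehat f(A)\prod_{j\in A}x_j$ and is of degree at most $d$ if $\widehat f(A)=0$ for $|A|>d$. $\mathrm{BH}^{\le d}_{\{\pm1\}}$ denotes the best constant $C$ (known to be finite) such that $\big(\sum_{|A|\le d}|\widehat f(A)|^{\frac{2d}{d+1}}\big)^{\frac{d+1}{2d}}\le C\|f\|_\infty$ for all $N\ge1$ and all $f:\{-1,1\}^N\to[-1,1]$ of degree at most $d$. *)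

theory Defs
  imports "HOL-Library.FuncSet" "Jordan_Normal_Form.Schur_Decomposition"
begin

section \<open>Operators on a tensor power\<close>

text \<open>
  The algebra of K by K matrices, tensored n times, is represented by complex matrices of
  size \<open>K ^ n\<close> via the Kronecker product. All indices are 0-based.
\<close>

definition kronecker :: "complex mat \<Rightarrow> complex mat \<Rightarrow> complex mat" (infixr "\<otimes>\<^sub>K" 70) where
  "A \<otimes>\<^sub>K B = mat (dim_row A * dim_row B) (dim_col A * dim_col B)
     (\<lambda>(i, j). A $$ (i div dim_row B, j div dim_col B) * B $$ (i mod dim_row B, j mod dim_col B))"

definition kronecker_list :: "complex mat list \<Rightarrow> complex mat" where
  "kronecker_list As = foldr (\<otimes>\<^sub>K) As (1\<^sub>m 1)"

definition hermitian_mat :: "complex mat \<Rightarrow> bool" where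
  "hermitian_mat A \<longleftrightarrow> mat_adjoint A = A"

definition l2_norm_vec :: "complex vec \<Rightarrow> real" where
  "l2_norm_vec v = sqrt (\<Sum>i<dim_vec v. (cmod (v $ i))\<^sup>2)"

definition op_norm_mat :: "complex mat \<Rightarrow> real" where
  "op_norm_mat A =
     (SUP v \<in> {v \<in> carrier_vec (dim_col A). l2_norm_vec v \<le> 1}. l2_norm_vec (A *\<^sub>v v))"

section \<open>The Gell-Mann basis\<close>

definition matrix_unit :: "nat \<Rightarrow> nat \<Rightarrow> nat \<Rightarrow> complex mat" where
  "matrix_unit K j k = mat K K (\<lambda>(a, b). if a = j \<and> b = k then 1 else 0)"

datatype gm_index = GM_I | GM_A nat nat | GM_B nat nat | GM_C nat

definition gm_indices :: "nat \<Rightarrow> gm_index set" where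
  "gm_indices K = {GM_I} \<union> {GM_A j k | j k. j < k \<and> k < K} \<union> {GM_B j k | j k. j < k \<and> k < K}
     \<union> {GM_C m | m. 1 \<le> m \<and> m < K}"

text \<open>
  With 0-based indices, the diagonal matrix \<open>GM_C m\<close> is built from the matrix units
  at \<open>0, \<dots>, m - 1\<close> and at \<open>m\<close>, the latter with weight \<open>- m\<close>.
\<close>

fun gm_matrix :: "nat \<Rightarrow> gm_index \<Rightarrow> complex mat" where
  "gm_matrix K GM_I = 1\<^sub>m K"
| "gm_matrix K (GM_A j k) =
     complex_of_real (sqrt (real K / 2)) \<cdot>\<^sub>m (matrix_unit K j k + matrix_unit K k j)"
| "gm_matrix K (GM_B j k) =
     complex_of_real (sqrt (real K / 2)) \<cdot>\<^sub>m
       ((- \<i>) \<cdot>\<^sub>m matrix_unit K j k + \<i> \<cdot>\<^sub>m matrix_unit K k j)"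
| "gm_matrix K (GM_C m) =
     complex_of_real (sqrt (real K / real (m\<^sup>2 + m))) \<cdot>\<^sub>m
       (mat K K (\<lambda>p. \<Sum>k<m. matrix_unit K k k $$ p) - of_nat m \<cdot>\<^sub>m matrix_unit K m m)"

definition gm_words :: "nat \<Rightarrow> nat \<Rightarrow> gm_index list set" where
  "gm_words K n = {\<alpha>. set \<alpha> \<subseteq> gm_indices K \<and> length \<alpha> = n}"

definition gm_tensor :: "nat \<Rightarrow> gm_index list \<Rightarrow> complex mat" where
  "gm_tensor K \<alpha> = kronecker_list (map (gm_matrix K) \<alpha>)"

definition gm_weight :: "nat \<Rightarrow> gm_index list \<Rightarrow> nat" where
  "gm_weight K \<alpha> = card {j. j < length \<alpha> \<and> gm_matrix K (\<alpha> ! j) \<noteq> 1\<^sub>m K}"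

text \<open>
  The coefficient family is the unique one expanding \<open>A\<close> in the tensor basis. Outside
  \<open>gm_words K n\<close> it is pinned to \<open>undefined\<close>, so that it is unique as a total function.
\<close>

definition gm_coeff :: "nat \<Rightarrow> nat \<Rightarrow> complex mat \<Rightarrow> gm_index list \<Rightarrow> complex" where
  "gm_coeff K n A = (THE c. c \<in> extensional (gm_words K n) \<and>
     A = mat (K ^ n) (K ^ n) (\<lambda>p. \<Sum>\<alpha>\<in>gm_words K n. c \<alpha> * gm_tensor K \<alpha> $$ p))"

definition gm_degree_le :: "nat \<Rightarrow> nat \<Rightarrow> nat \<Rightarrow> complex mat \<Rightarrow> bool" where
  "gm_degree_le K n d A \<longleftrightarrow> (\<forall>\<alpha>\<in>gm_words K n. gm_weight K \<alpha> > d \<longrightarrow> gm_coeff K n A \<alpha> = 0)"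

section \<open>The Bohnenblust--Hille constant of the Boolean cube\<close>

definition cube :: "nat \<Rightarrow> (nat \<Rightarrow> real) set" where
  "cube N = {..<N} \<rightarrow>\<^sub>E {-1, 1}"

definition cube_coeff :: "nat \<Rightarrow> ((nat \<Rightarrow> real) \<Rightarrow> real) \<Rightarrow> nat set \<Rightarrow> real" where
  "cube_coeff N f = (THE c. c \<in> extensional (Pow {..<N}) \<and>
     (\<forall>x\<in>cube N. f x = (\<Sum>S\<in>Pow {..<N}. c S * (\<Prod>j\<in>S. x j))))"

definition cube_degree_le :: "nat \<Rightarrow> nat \<Rightarrow> ((nat \<Rightarrow> real) \<Rightarrow> real) \<Rightarrow> bool" where
  "cube_degree_le N d f \<longleftrightarrow> (\<forall>S\<in>Pow {..<N}. card S > d \<longrightarrow> cube_coeff N f S = 0)"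

definition cube_sup_norm :: "nat \<Rightarrow> ((nat \<Rightarrow> real) \<Rightarrow> real) \<Rightarrow> real" where
  "cube_sup_norm N f = (SUP x\<in>cube N. \<bar>f x\<bar>)"

definition is_BH_cube_bound :: "nat \<Rightarrow> real \<Rightarrow> bool" where
  "is_BH_cube_bound d C \<longleftrightarrow>
     (\<forall>N f. 1 \<le> N \<longrightarrow> f \<in> cube N \<rightarrow> {-1..1} \<longrightarrow> cube_degree_le N d f \<longrightarrow>
       (\<Sum>S | S \<subseteq> {..<N} \<and> card S \<le> d. \<bar>cube_coeff N f S\<bar> powr (2 * real d / (real d + 1)))
         powr ((real d + 1) / (2 * real d)) \<le> C * cube_sup_norm N f)"

text \<open>
  The set of admissible constants is bounded below (test \<open>f = 1\<close>); that it is nonempty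
  is the Bohnenblust--Hille inequality for the Boolean cube.
\<close>

definition BH_cube :: "nat \<Rightarrow> real" where
  "BH_cube d = Inf {C. is_BH_cube_bound d C}"

end

theory Submission
  imports Defs "HOL-Analysis.Convex"
begin

text \<open>
  Replace each site of the qudit system by a random state. For signs \<open>w\<close> indexed by the
  non-identity elements of the Gell-Mann basis, consider
  \<open>\<rho>(w) = (1/K) (I + (1/s) \<Sum> w\<^sub>r M\<^sub>r)\<close> with \<open>s = 3/2 (K\<^sup>2 - K)\<close>. The number \<open>s\<close> is large
  enough for \<open>\<rho>(w)\<close> to be positive, so it is a density matrix, and by orthonormality
  \<open>tr (\<rho>(w) M\<^sub>r) = w\<^sub>r / s\<close>. Give every site its own signs. The expectation of \<open>A\<close> in the product
  state is then a real function of the signs that is bounded by the operator norm of \<open>A\<close>. Its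
  Fourier coefficients are the Gell-Mann coefficients of \<open>A\<close>, each divided by \<open>s\<close> to the power of
  its weight. The Bohnenblust--Hille inequality on the Boolean cube therefore passes to \<open>A\<close> at the
  cost of \<open>s\<^sup>d\<close>. This is \<open>gm_Bohnenblust_Hille\<close>; the states are built in \<open>state_value_gm\<close>.

  Positivity of \<open>\<rho>(w)\<close> is used in the form of an explicit mixture of unit vectors: the vectors
  \<open>(e\<^sub>j \<plusminus> e\<^sub>k)/\<surd>2\<close> and \<open>(e\<^sub>j \<plusminus> i e\<^sub>k)/\<surd>2\<close> produce the off-diagonal part, and the basis vectors
  correct the diagonal. A mixture of product vectors has an expectation that is an average of
  quadratic forms, and each of these is at most the operator norm. The same functional
  separates coefficient families, which makes the Gell-Mann expansion unique, and it takes real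
  values on observables, which makes their coefficients real. Existence of the expansion comes from
  the completeness relation \<open>gm_tensor_completeness\<close>.

  The constant of the cube is an infimum, and it says something only if it ranges over a nonempty
  set. So the Boolean inequality has to be proved with some constant, in \<open>Boolean_Bohnenblust_Hille\<close>.
  For \<open>f\<close> of degree \<open>d\<close>, let \<open>g(i)\<close> be the \<open>\<ell>\<^sup>2\<close> norm of the coefficients of the sets containing \<open>i\<close>.
  The arithmetic-geometric mean inequality bounds the \<open>2d/(d+1)\<close>-norm of the
  coefficients in terms of \<open>\<Sum> g(i)\<close> (\<open>mixed_norm_bound\<close>), directly on sets and without passing to
  multilinear forms. Hypercontractivity replaces \<open>g(i)\<close> by the mean of \<open>\<bar>D\<^sub>i f\<bar>\<close>
  (\<open>walsh_L2_le_L1\<close>), and at every point \<open>\<Sum> \<bar>D\<^sub>i f\<bar>\<close> is bounded by a multiple of \<open>\<parallel>f\<parallel>\<close>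
  because a bounded polynomial on an interval has a bounded derivative at the endpoint
  (\<open>total_influence_bound\<close>).
\<close>

section \<open>Walsh polynomials on the sign cube\<close>

definition signs :: "'a set \<Rightarrow> ('a \<Rightarrow> real) set" where
  "signs I = I \<rightarrow>\<^sub>E {-1, 1}"

definition walsh :: "'a set \<Rightarrow> ('a set \<Rightarrow> real) \<Rightarrow> ('a \<Rightarrow> real) \<Rightarrow> real" where
  "walsh I c x = (\<Sum>S\<in>Pow I. c S * (\<Prod>j\<in>S. x j))"

definition sign_avg :: "'a set \<Rightarrow> (('a \<Rightarrow> real) \<Rightarrow> real) \<Rightarrow> real" where
  "sign_avg I F = (\<Sum>x\<in>signs I. F x) / 2 ^ card I"

lemma sum_Pow_insert:
  fixes F :: "'a set \<Rightarrow> real"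
  assumes "finite I" "i \<notin> I"
  shows "(\<Sum>S\<in>Pow (insert i I). F S) = (\<Sum>S\<in>Pow I. F S) + (\<Sum>S\<in>Pow I. F (insert i S))"
proof -
  have "(\<Sum>S\<in>Pow (insert i I). F S) = (\<Sum>S\<in>Pow I. F S) + (\<Sum>S\<in>insert i ` Pow I. F S)"
    unfolding Pow_insert by (rule sum.union_disjoint) (use assms in auto)
  moreover have "inj_on (insert i) (Pow I)"
    using assms by (auto simp: inj_on_def) 
  ultimately show ?thesis by (simp add: sum.reindex)
qed

text \<open>
  Splitting off one variable writes a Walsh polynomial as \<open>b + x\<^sub>i a\<close>; every induction on the
  number of variables below rests on this.
\<close>

lemma walsh_insert:
  assumes "finite I" "i \<notin> I"
  shows "walsh (insert i I) c x = walsh I c x + x i * walsh I (\<lambda>S. c (insert i S)) x"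
proof -
  have "c (insert i S) * prod x (insert i S) = x i * (c (insert i S) * prod x S)" if "S \<in> Pow I" for S
    using that assms by (subst prod.insert) (auto intro: finite_subset)
  then show ?thesis
    unfolding walsh_def sum_Pow_insert[OF assms] sum_distrib_left
    by (intro arg_cong2[where f = "(+)"] refl sum.cong)
qed

lemma walsh_upd: "i \<notin> I \<Longrightarrow> walsh I c (x(i := t)) = walsh I c x"
  unfolding walsh_def by (intro sum.cong refl arg_cong2[where f = "(*)"] prod.cong) auto

lemma walsh_add: "walsh I (\<lambda>S. a S + b S) x = walsh I a x + walsh I b x"
  by (simp add: walsh_def algebra_simps sum.distrib)

lemma walsh_scale: "walsh I (\<lambda>S. t * a S) x = t * walsh I a x"
  by (simp add: walsh_def sum_distrib_left mult.assoc)

lemma walsh_diff: "walsh I (\<lambda>S. a S - b S) x = walsh I a x - walsh I b x"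
  by (simp add: walsh_def algebra_simps sum_subtractf)

lemma sum_signs_insert:
  assumes "finite I" "i \<notin> I"
  shows "(\<Sum>x\<in>signs (insert i I). F x) = (\<Sum>x\<in>signs I. F (x(i := 1)) + F (x(i := -1)))"
proof -
  have "(\<Sum>x\<in>signs (insert i I). F x) = (\<Sum>(t, x)\<in>{-1,1} \<times> signs I. F (x(i := t)))"
    unfolding signs_def PiE_insert_eq
    by (subst sum.reindex[OF inj_combinator[OF assms(2)]]) (simp add: case_prod_unfold)
  also have "\<dots> = (\<Sum>t\<in>{-1,1::real}. \<Sum>x\<in>signs I. F (x(i := t)))"
    by (simp add: sum.cartesian_product)
  finally show ?thesis by (simp add: sum.distrib add.commute)
qed

lemma sign_avg_insert:
  assumes "finite I" "i \<notin> I"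
  shows "sign_avg (insert i I) F = sign_avg I (\<lambda>x. (F (x(i := 1)) + F (x(i := -1))) / 2)"
  using assms unfolding sign_avg_def sum_signs_insert[OF assms]
  by (simp add: sum_divide_distrib[symmetric] add_divide_distrib[symmetric])

lemma sign_avg_add: "sign_avg I (\<lambda>x. F x + H x) = sign_avg I F + sign_avg I H"
  by (simp add: sign_avg_def sum.distrib add_divide_distrib)

lemma sign_avg_scale: "sign_avg I (\<lambda>x. t * F x) = t * sign_avg I F"
  by (simp add: sign_avg_def sum_distrib_left)

lemma sign_avg_cong: "(\<And>x. x \<in> signs I \<Longrightarrow> F x = H x) \<Longrightarrow> sign_avg I F = sign_avg I H"
  by (simp add: sign_avg_def)

lemma sign_avg_nonneg: "(\<And>x. x \<in> signs I \<Longrightarrow> 0 \<le> F x) \<Longrightarrow> 0 \<le> sign_avg I F"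
  by (simp add: sign_avg_def sum_nonneg)

lemma card_signs: "finite I \<Longrightarrow> card (signs I) = 2 ^ card I"
  by (simp add: signs_def card_PiE card_insert_if numeral_2_eq_2)

lemma sign_avg_le:
  assumes "finite I" "\<And>x. x \<in> signs I \<Longrightarrow> F x \<le> M"
  shows "sign_avg I F \<le> M"
  using sum_bounded_above[of "signs I" F M] assms
  by (simp add: sign_avg_def card_signs field_simps)

lemma sign_avg_Cauchy_Schwarz:
  "(sign_avg I (\<lambda>x. F x * H x))\<^sup>2 \<le> sign_avg I (\<lambda>x. (F x)\<^sup>2) * sign_avg I (\<lambda>x. (H x)\<^sup>2)"
proof -
  have "(\<Sum>x\<in>signs I. F x * H x)\<^sup>2 \<le> (\<Sum>x\<in>signs I. (F x)\<^sup>2) * (\<Sum>x\<in>signs I. (H x)\<^sup>2)"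
    by (rule Cauchy_Schwarz_ineq_sum)
  then show ?thesis
    by (simp add: sign_avg_def power_divide divide_simps power2_eq_square)
qed

lemma walsh_parseval:
  assumes "finite I"
  shows "sign_avg I (\<lambda>x. (walsh I c x)\<^sup>2) = (\<Sum>S\<in>Pow I. (c S)\<^sup>2)"
  using assms
proof (induction I arbitrary: c rule: finite_induct)
  case empty
  then show ?case by (simp add: sign_avg_def walsh_def signs_def)
next
  case (insert i I)
  let ?a = "\<lambda>S. c (insert i S)"
  have "sign_avg (insert i I) (\<lambda>x. (walsh (insert i I) c x)\<^sup>2)
      = sign_avg I (\<lambda>x. (walsh I c x)\<^sup>2 + (walsh I ?a x)\<^sup>2)"
    unfolding sign_avg_insert[OF insert.hyps] walsh_insert[OF insert.hyps] walsh_upd[OF insert.hyps(2)]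
    by (rule sign_avg_cong) (simp add: power2_eq_square field_simps)
  then show ?case
    by (simp add: sign_avg_add insert.IH sum_Pow_insert[OF insert.hyps])
qed

text \<open>
  The squares of the coefficients add up to the mean square of the polynomial, so a polynomial that
  vanishes on the cube has no coefficients.
\<close>

lemma walsh_eq_0_imp_coeff_0:
  assumes "finite I" "\<And>x. x \<in> signs I \<Longrightarrow> walsh I c x = 0" "S \<subseteq> I"
  shows "c S = 0"
proof -
  have "sign_avg I (\<lambda>x. (walsh I c x)\<^sup>2) = 0"
    using assms(2) by (simp add: sign_avg_def)
  then have "(\<Sum>S\<in>Pow I. (c S)\<^sup>2) = 0"
    using walsh_parseval[OF assms(1)] by metis
  then show ?thesis using assms by (simp add: sum_nonneg_eq_0_iff)
qed

text \<open>
  In each new variable, a function is its even part plus the variable times its odd part.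
\<close>

lemma walsh_expansion_exists:
  assumes "finite I"
  shows "\<exists>c. \<forall>x\<in>signs I. f x = walsh I c x"
  using assms
proof (induction I arbitrary: f rule: finite_induct)
  case empty
  show ?case
    by (rule exI[of _ "\<lambda>_. f (\<lambda>_. undefined)"]) (simp add: walsh_def signs_def)
next
  case (insert i I)
  obtain a where a: "\<forall>x\<in>signs I. (f (x(i := 1)) - f (x(i := -1))) / 2 = walsh I a x"
    using insert.IH[of "\<lambda>x. (f (x(i := 1)) - f (x(i := -1))) / 2"] by blast
  obtain b where b: "\<forall>x\<in>signs I. (f (x(i := 1)) + f (x(i := -1))) / 2 = walsh I b x"
    using insert.IH[of "\<lambda>x. (f (x(i := 1)) + f (x(i := -1))) / 2"] by blast
  define c where "c = (\<lambda>S. if i \<in> S then a (S - {i}) else b S)"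
  have "f x = walsh (insert i I) c x" if "x \<in> signs (insert i I)" for x
  proof -
    have "x \<in> (\<lambda>(t, y). y(i := t)) ` ({-1, 1} \<times> signs I)"
      using that by (simp add: signs_def PiE_insert_eq)
    then obtain t y where ty: "t \<in> {-1, 1}" "y \<in> signs I" "x = y(i := t)" by fast
    have cb: "walsh I c y = walsh I b y"
      using insert.hyps unfolding walsh_def c_def by (intro sum.cong) auto
    have ca: "walsh I (\<lambda>S. c (insert i S)) y = walsh I a y"
      unfolding walsh_def
    proof (intro sum.cong refl)
      fix S assume "S \<in> Pow I"
      then have "insert i S - {i} = S" using insert.hyps by auto
      then show "c (insert i S) * prod y S = a S * prod y S" by (simp add: c_def)
    qed
    show ?thesis
      unfolding ty walsh_insert[OF insert.hyps] walsh_upd[OF insert.hyps(2)] ca cb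
      using a[rule_format, OF ty(2)] b[rule_format, OF ty(2)] ty(1) by (auto simp: field_simps)
  qed
  then show ?case by blast
qed

section \<open>Hypercontractivity\<close>

text \<open>
  The average of the fourth power over one sign; the left-hand side has the shape in which
  \<open>walsh_insert\<close> leaves the two values of the variable.
\<close>

lemma fourth_moment:
  "((b + 1 * a) ^ 4 + (b + - 1 * a) ^ 4) / 2 = a ^ 4 + (6 * (a\<^sup>2 * b\<^sup>2) + b ^ 4)" for a b :: real
  by (simp add: power4_eq_xxxx power2_eq_square algebra_simps)

text \<open>
  This is Bonami's inequality. With \<open>f = b + x\<^sub>i a\<close>, the fourth moment of \<open>f\<close> is that of \<open>a\<close> plus
  that of \<open>b\<close> plus \<open>6\<close> times the mean of \<open>a\<^sup>2 b\<^sup>2\<close>. The polynomial \<open>a\<close> has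
  smaller degree, so its constant is smaller by a factor \<open>9\<close>. By Cauchy--Schwarz this
  gains a factor \<open>3\<close> in the mixed term, and the right-hand side becomes a perfect square.
\<close>

lemma walsh_hypercontractive:
  assumes "finite I" "\<And>S. S \<subseteq> I \<Longrightarrow> d < card S \<Longrightarrow> c S = 0"
  shows "sign_avg I (\<lambda>x. (walsh I c x) ^ 4) \<le> 9 ^ d * (\<Sum>S\<in>Pow I. (c S)\<^sup>2)\<^sup>2"
  using assms
proof (induction I arbitrary: c d rule: finite_induct)
  case empty
  have "(1::real) * c {} ^ 4 \<le> 9 ^ d * c {} ^ 4"
    by (rule mult_right_mono) auto
  then show ?case by (simp add: sign_avg_def walsh_def signs_def power_mult[symmetric])
next
  case (insert i I)
  define a where "a = (\<lambda>S. c (insert i S))"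
  define \<alpha> where "\<alpha> = (\<Sum>S\<in>Pow I. (a S)\<^sup>2)"
  define \<beta> where "\<beta> = (\<Sum>S\<in>Pow I. (c S)\<^sup>2)"
  define A where "A = sign_avg I (\<lambda>x. (walsh I a x) ^ 4)"
  define B where "B = sign_avg I (\<lambda>x. (walsh I c x) ^ 4)"
  define X where "X = sign_avg I (\<lambda>x. (walsh I a x)\<^sup>2 * (walsh I c x)\<^sup>2)"
  have nn: "\<alpha> \<ge> 0" "\<beta> \<ge> 0" "A \<ge> 0" "B \<ge> 0" "X \<ge> 0"
    unfolding \<alpha>_def \<beta>_def A_def B_def X_def by (auto intro!: sum_nonneg sign_avg_nonneg)
  have B: "B \<le> 9 ^ d * \<beta>\<^sup>2"
    unfolding B_def \<beta>_def by (rule insert.IH) (use insert.prems in auto)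
  have A: "9 * A \<le> 9 ^ d * \<alpha>\<^sup>2"
  proof (cases d)
    case 0
    have "a S = 0" if "S \<subseteq> I" for S
    proof -
      have "finite S" using that insert.hyps(1) finite_subset by blast
      then show ?thesis
        unfolding a_def by (intro insert.prems) (use that 0 in \<open>auto simp: card_gt_0_iff\<close>)
    qed
    then have "walsh I a x = 0" for x by (simp add: walsh_def)
    then show ?thesis using nn by (simp add: A_def sign_avg_def)
  next
    case (Suc e)
    have "A \<le> 9 ^ e * \<alpha>\<^sup>2"
      unfolding A_def \<alpha>_def
    proof (rule insert.IH)
      fix S assume S: "S \<subseteq> I" "e < card S"
      then have "card (insert i S) = Suc (card S)"
        using insert.hyps by (intro card_insert_disjoint) (auto intro: finite_subset)
      then show "a S = 0"
        unfolding a_def using S Suc by (intro insert.prems) auto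
    qed
    then show ?thesis by (simp add: Suc)
  qed
  have "X\<^sup>2 \<le> A * B"
    using sign_avg_Cauchy_Schwarz[of I "\<lambda>x. (walsh I a x)\<^sup>2" "\<lambda>x. (walsh I c x)\<^sup>2"]
    by (simp add: X_def A_def B_def power_mult[symmetric])
  then have "(3 * X)\<^sup>2 \<le> (9 * A) * B" by (simp add: power2_eq_square)
  also have "\<dots> \<le> (9 ^ d * \<alpha>\<^sup>2) * (9 ^ d * \<beta>\<^sup>2)"
    using mult_mono[OF A B] nn by simp
  also have "\<dots> = (9 ^ d * (\<alpha> * \<beta>))\<^sup>2" by (simp add: power2_eq_square algebra_simps)
  finally have X: "3 * X \<le> 9 ^ d * (\<alpha> * \<beta>)"
    by (rule power2_le_imp_le) (use nn in simp)
  have "sign_avg (insert i I) (\<lambda>x. (walsh (insert i I) c x) ^ 4)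
      = sign_avg I (\<lambda>x. (walsh I a x) ^ 4 + (6 * ((walsh I a x)\<^sup>2 * (walsh I c x)\<^sup>2) + (walsh I c x) ^ 4))"
    unfolding sign_avg_insert[OF insert.hyps] walsh_insert[OF insert.hyps] walsh_upd[OF insert.hyps(2)]
      a_def[symmetric]
    by (rule sign_avg_cong)
       (use fourth_moment[of "walsh I c _" "walsh I a _"] in \<open>simp only: fun_upd_same\<close>)
  also have "\<dots> = A + 6 * X + B"
    by (simp add: sign_avg_add sign_avg_scale A_def B_def X_def)
  also have "\<dots> \<le> 9 ^ d * \<alpha>\<^sup>2 + 2 * (9 ^ d * (\<alpha> * \<beta>)) + 9 ^ d * \<beta>\<^sup>2"
    using A B X nn by linarith
  also have "\<dots> = 9 ^ d * (\<beta> + \<alpha>)\<^sup>2" by (simp add: power2_eq_square algebra_simps)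
  finally show ?case
    by (simp add: sum_Pow_insert[OF insert.hyps] \<alpha>_def \<beta>_def a_def)
qed

text \<open>
  Log-convexity of moments: two applications of Cauchy--Schwarz bound the second moment by the first
  and the fourth, and hypercontractivity bounds the fourth by the second.
\<close>

lemma walsh_L2_le_L1:
  assumes "finite I" "\<And>S. S \<subseteq> I \<Longrightarrow> d < card S \<Longrightarrow> c S = 0"
  shows "sqrt (\<Sum>S\<in>Pow I. (c S)\<^sup>2) \<le> 3 ^ d * sign_avg I (\<lambda>x. \<bar>walsh I c x\<bar>)"
proof -
  define m where "m k = sign_avg I (\<lambda>x. \<bar>walsh I c x\<bar> ^ k)" for k
  have nn: "m k \<ge> 0" for k unfolding m_def by (intro sign_avg_nonneg) auto
  have m2: "m 2 = (\<Sum>S\<in>Pow I. (c S)\<^sup>2)"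
    using walsh_parseval[OF assms(1)] by (simp add: m_def)
  have m4: "m 4 \<le> 9 ^ d * (m 2)\<^sup>2"
    unfolding m2 using walsh_hypercontractive[OF assms] by (simp add: m_def)
  have m3: "(m 3)\<^sup>2 \<le> m 2 * m 4"
  proof -
    have "m 3 = sign_avg I (\<lambda>x. \<bar>walsh I c x\<bar> * \<bar>walsh I c x\<bar>\<^sup>2)"
      unfolding m_def by (rule sign_avg_cong) (simp add: power3_eq_cube power2_eq_square)
    moreover have "m 4 = sign_avg I (\<lambda>x. (\<bar>walsh I c x\<bar>\<^sup>2)\<^sup>2)"
      unfolding m_def by (rule sign_avg_cong) simp
    ultimately show ?thesis
      using sign_avg_Cauchy_Schwarz[of I "\<lambda>x. \<bar>walsh I c x\<bar>" "\<lambda>x. \<bar>walsh I c x\<bar>\<^sup>2"]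
      unfolding m_def by simp
  qed
  have h2: "m 2 = sign_avg I (\<lambda>x. sqrt \<bar>walsh I c x\<bar> * (sqrt \<bar>walsh I c x\<bar> * \<bar>walsh I c x\<bar>))"
  proof -
    have "t\<^sup>2 = sqrt t * (sqrt t * t)" if "t \<ge> 0" for t :: real
      unfolding mult.assoc[symmetric] using that by (simp add: power2_eq_square)
    from this[OF abs_ge_zero] show ?thesis unfolding m_def by (intro sign_avg_cong)
  qed
  have h1: "m 1 = sign_avg I (\<lambda>x. (sqrt \<bar>walsh I c x\<bar>)\<^sup>2)"
    unfolding m_def by (rule sign_avg_cong) simp
  have h3: "m 3 = sign_avg I (\<lambda>x. (sqrt \<bar>walsh I c x\<bar> * \<bar>walsh I c x\<bar>)\<^sup>2)"
  proof -
    have "t ^ 3 = (sqrt t * t)\<^sup>2" if "t \<ge> 0" for t :: real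
      unfolding power_mult_distrib using that by (simp add: power_numeral_reduce)
    from this[OF abs_ge_zero] show ?thesis unfolding m_def by (intro sign_avg_cong)
  qed
  have "(m 2)\<^sup>2 \<le> m 1 * m 3"
    unfolding h1 h2 h3 by (rule sign_avg_Cauchy_Schwarz)
  then have "((m 2)\<^sup>2)\<^sup>2 \<le> (m 1 * m 3)\<^sup>2" by (rule power_mono) simp
  also have "\<dots> = (m 1)\<^sup>2 * (m 3)\<^sup>2" by (simp add: power_mult_distrib)
  also have "\<dots> \<le> (m 1)\<^sup>2 * (m 2 * m 4)" using m3 by (intro mult_left_mono) auto
  also have "\<dots> \<le> (m 1)\<^sup>2 * (m 2 * (9 ^ d * (m 2)\<^sup>2))"
    using m4 nn by (intro mult_left_mono) auto
  finally have *: "m 2 ^ 3 * m 2 \<le> m 2 ^ 3 * (9 ^ d * (m 1)\<^sup>2)"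
    by (simp add: power2_eq_square power3_eq_cube algebra_simps)
  have "m 2 \<le> 9 ^ d * (m 1)\<^sup>2"
  proof (cases "m 2 = 0")
    case False
    then have "m 2 ^ 3 > 0" using nn[of 2] by auto
    then show ?thesis using * by (rule mult_left_le_imp_le[rotated])
  qed simp
  also have "\<dots> = (3 ^ d * m 1)\<^sup>2"
  proof -
    have "(3 ^ d)\<^sup>2 = (9::real) ^ d" by (simp add: power2_eq_square flip: power_mult_distrib)
    then show ?thesis by (simp add: power_mult_distrib)
  qed
  finally show ?thesis
    using nn[of 1] unfolding m2[symmetric] by (intro real_le_lsqrt) (auto simp: m_def)
qed

section \<open>The total influence of a bounded polynomial\<close>

text \<open>
  In each variable the polynomial is affine, so its extremal values over the solid cube are attained at
  vertices.
\<close>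

lemma walsh_bounded_on_solid_cube:
  assumes "finite I" "\<And>y. y \<in> signs I \<Longrightarrow> \<bar>walsh I c y\<bar> \<le> M" "\<And>j. j \<in> I \<Longrightarrow> \<bar>x j\<bar> \<le> 1"
  shows "\<bar>walsh I c x\<bar> \<le> M"
  using assms
proof (induction I arbitrary: c rule: finite_induct)
  case empty
  then show ?case by (auto simp: walsh_def signs_def)
next
  case (insert i I)
  let ?c = "\<lambda>S. c S + x i * c (insert i S)"
  have "\<bar>walsh I ?c x\<bar> \<le> M"
  proof (rule insert.IH)
    fix y assume y: "y \<in> signs I"
    then have "y(i := t) \<in> signs (insert i I)" if "t \<in> {-1, 1}" for t
      using that unfolding signs_def PiE_insert_eq by force
    note * = insert.prems(1)[OF this[of 1]] insert.prems(1)[OF this[of "-1"]]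
    define p q where "p = walsh I c y" and "q = walsh I (\<lambda>S. c (insert i S)) y"
    have pq: "\<bar>p + q\<bar> \<le> M" "\<bar>p - q\<bar> \<le> M"
      using * unfolding walsh_insert[OF insert.hyps] walsh_upd[OF insert.hyps(2)] p_def q_def
      by simp_all
    have "\<bar>x i\<bar> \<le> 1" using insert.prems by simp
    then have "\<bar>x i * q\<bar> \<le> \<bar>q\<bar>" by (simp add: abs_mult mult_left_le_one_le)
    then have "\<bar>p + x i * q\<bar> \<le> M" using pq by linarith
    then show "\<bar>walsh I ?c y\<bar> \<le> M" by (simp add: walsh_add walsh_scale p_def q_def)
  qed (use insert.prems in auto)
  then show ?case by (simp add: walsh_insert[OF insert.hyps] walsh_add walsh_scale)
qed

text \<open>
  A substitute for Markov's inequality at the endpoint of an interval, with an unspecified constant.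
  The combination \<open>2\<^sup>d q(t/2) - q(t)\<close> cancels the top coefficient of a polynomial of degree \<open>d\<close>, stays
  bounded on the interval, and multiplies each lower coefficient by a factor of at least \<open>1\<close>.
\<close>

lemma linear_coeff_bound:
  assumes "d \<ge> 1"
  shows "\<exists>C\<ge>0. \<forall>b M. (\<forall>t\<in>{0..1::real}. \<bar>\<Sum>k\<le>d. b k * t ^ k\<bar> \<le> M) \<longrightarrow> \<bar>b 1 :: real\<bar> \<le> C * M"
  using assms
proof (induction d rule: nat_induct_at_least)
  case base
  have "\<bar>b 1\<bar> \<le> 2 * M" if "\<forall>t\<in>{0..1::real}. \<bar>\<Sum>k\<le>1. b k * t ^ k\<bar> \<le> M" for b :: "nat \<Rightarrow> real" and M
    using bspec[OF that, of 0] bspec[OF that, of 1] by simp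
  then show ?case by (intro exI[of _ 2]) auto
next
  case (Suc d)
  then obtain C where C: "C \<ge> 0"
    "\<And>b M. (\<forall>t\<in>{0..1::real}. \<bar>\<Sum>k\<le>d. b k * t ^ k\<bar> \<le> M) \<Longrightarrow> \<bar>b 1 :: real\<bar> \<le> C * M"
    by blast
  have "\<bar>b 1\<bar> \<le> C * (2 ^ Suc d + 1) * M"
    if b: "\<forall>t\<in>{0..1::real}. \<bar>\<Sum>k\<le>Suc d. b k * t ^ k\<bar> \<le> M" for b :: "nat \<Rightarrow> real" and M
  proof -
    define q where "q t = (\<Sum>k\<le>Suc d. b k * t ^ k)" for t
    define a where "a k = b k * (2 ^ (Suc d - k) - 1)" for k
    have q_eq: "2 ^ Suc d * q (t / 2) - q t = (\<Sum>k\<le>d. a k * t ^ k)" for t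
    proof -
      have "2 ^ Suc d * q (t / 2) - q t = (\<Sum>k\<le>Suc d. a k * t ^ k)"
        unfolding q_def sum_distrib_left sum_subtractf[symmetric]
        by (intro sum.cong refl) (auto simp: a_def power_divide power_diff algebra_simps)
      then show ?thesis by (simp add: a_def)
    qed
    have "\<bar>a 1\<bar> \<le> C * ((2 ^ Suc d + 1) * M)"
    proof (rule C(2), intro ballI)
      fix t :: real assume t: "t \<in> {0..1}"
      have "\<bar>q (t / 2)\<bar> \<le> M" "\<bar>q t\<bar> \<le> M"
        using bspec[OF b, of "t / 2"] bspec[OF b, of t] t unfolding q_def by simp_all
      then have "\<bar>2 ^ Suc d * q (t / 2)\<bar> \<le> 2 ^ Suc d * M" by (simp add: abs_mult)
      then show "\<bar>\<Sum>k\<le>d. a k * t ^ k\<bar> \<le> (2 ^ Suc d + 1) * M"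
        unfolding q_eq[symmetric] using \<open>\<bar>q t\<bar> \<le> M\<close> by (simp add: algebra_simps)
    qed
    moreover have "(2::real) ^ d \<ge> 2 ^ 1" using Suc by (intro power_increasing) auto
    then have "\<bar>b 1\<bar> * 1 \<le> \<bar>a 1\<bar>" unfolding a_def abs_mult by (intro mult_left_mono) auto
    ultimately show ?thesis by (simp add: mult.assoc)
  qed
  then show ?case using C(1) by (intro exI[of _ "C * (2 ^ Suc d + 1)"]) auto
qed

text \<open>
  Shrink and flip the variables in a set \<open>J\<close> simultaneously, replacing \<open>x\<^sub>j\<close> by \<open>(1 - 2 t) x\<^sub>j\<close>. The value is a
  polynomial in \<open>t\<close> of degree at most \<open>d\<close> that stays bounded on the unit interval, and its linear
  coefficient is \<open>- 2\<close> times the sum of the influences over \<open>J\<close>. Taking for \<open>J\<close> the variables with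
  nonnegative and those with negative influence at \<open>x\<close> gives the sum of absolute values.
  The influence \<open>x\<^sub>i \<partial>\<^sub>i f\<close> appears here as the part of \<open>f\<close> carried by the sets containing \<open>i\<close>.
\<close>

lemma total_influence_bound:
  assumes "d \<ge> 1"
  shows "\<exists>C\<ge>0. \<forall>(I :: 'a set) c M. \<forall>x\<in>signs I. finite I \<longrightarrow> (\<forall>S\<subseteq>I. d < card S \<longrightarrow> c S = 0) \<longrightarrow>
    (\<forall>y\<in>signs I. \<bar>walsh I c y\<bar> \<le> M) \<longrightarrow>
    (\<Sum>i\<in>I. \<bar>walsh I (\<lambda>S. if i \<in> S then c S else 0) x\<bar>) \<le> C * M"
proof -
  obtain C where C: "C \<ge> 0"
    "\<And>b M. (\<forall>t\<in>{0..1::real}. \<bar>\<Sum>k\<le>d. b k * t ^ k\<bar> \<le> M) \<Longrightarrow> \<bar>b 1 :: real\<bar> \<le> C * M"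
    using linear_coeff_bound[OF assms] by blast
  have "(\<Sum>i\<in>I. \<bar>walsh I (\<lambda>S. if i \<in> S then c S else 0) x\<bar>) \<le> C * M"
    if fin: "finite I" and deg: "\<And>S. S \<subseteq> I \<Longrightarrow> d < card S \<Longrightarrow> c S = 0"
      and bound: "\<And>y. y \<in> signs I \<Longrightarrow> \<bar>walsh I c y\<bar> \<le> M" and x: "x \<in> signs I"
    for I :: "'a set" and c M x
  proof -
    define D where "D i = walsh I (\<lambda>S. if i \<in> S then c S else 0) x" for i
    have flip: "2 * \<bar>\<Sum>i\<in>J. D i\<bar> \<le> C * M" if J: "J \<subseteq> I" for J
    proof -
      define y where "y t j = (if j \<in> J then x j * (1 - 2 * t) else x j)" for t :: real and j
      define b where "b k = (\<Sum>S\<in>Pow I. c S * prod x S * (real (card (S \<inter> J) choose k) * (-2) ^ k))" for k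
      have finS: "finite S" if "S \<subseteq> I" for S using that fin finite_subset by blast
      have y_poly: "walsh I c (y t) = (\<Sum>k\<le>d. b k * t ^ k)" for t
      proof -
        have term_poly: "c S * prod (y t) S
            = (\<Sum>k\<le>d. c S * prod x S * (real (card (S \<inter> J) choose k) * (-2) ^ k) * t ^ k)"
          if S: "S \<subseteq> I" for S
        proof (cases "d < card S")
          case False
          define m where "m = card (S \<inter> J)"
          have md: "m \<le> d" using False card_mono[of S "S \<inter> J"] finS[OF S] by (simp add: m_def)
          have "prod (y t) S = (\<Prod>j\<in>S. x j * (if j \<in> J then 1 - 2 * t else 1))"
            by (intro prod.cong) (auto simp: y_def)
          also have "\<dots> = prod x S * (1 - 2 * t) ^ m"
            by (simp add: prod.distrib prod.inter_restrict[OF finS[OF S], symmetric] m_def)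
          also have "(1 - 2 * t) ^ m = (\<Sum>k\<le>m. real (m choose k) * (-2) ^ k * t ^ k)"
            unfolding mult.assoc power_mult_distrib[symmetric]
            using binomial_ring[of "-2 * t" 1 m] by simp
          also have "\<dots> = (\<Sum>k\<le>d. real (m choose k) * (-2) ^ k * t ^ k)"
            by (rule sum.mono_neutral_left) (use md in auto)
          finally show ?thesis by (simp add: m_def sum_distrib_left mult.assoc)
        qed (simp add: deg[OF S])
        have "walsh I c (y t) = (\<Sum>S\<in>Pow I. \<Sum>k\<le>d. c S * prod x S * (real (card (S \<inter> J) choose k) * (-2) ^ k) * t ^ k)"
          unfolding walsh_def by (intro sum.cong refl term_poly) auto
        also have "\<dots> = (\<Sum>k\<le>d. b k * t ^ k)"
          unfolding b_def sum_distrib_right by (rule sum.swap)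
        finally show ?thesis .
      qed
      have "\<bar>b 1\<bar> \<le> C * M"
      proof (rule C(2), intro ballI)
        fix t :: real assume t: "t \<in> {0..1}"
        have y1: "\<bar>y t j\<bar> \<le> 1" if "j \<in> I" for j
        proof -
          have "\<bar>x j\<bar> = 1" using x that by (force simp: signs_def PiE_def Pi_def)
          then show ?thesis using t by (auto simp: y_def abs_mult)
        qed
        show "\<bar>\<Sum>k\<le>d. b k * t ^ k\<bar> \<le> M"
          unfolding y_poly[symmetric]
          by (rule walsh_bounded_on_solid_cube[OF fin]) (use bound y1 in auto)
      qed
      moreover have "b 1 = -2 * (\<Sum>i\<in>J. D i)"
      proof -
        have "real (card (S \<inter> J)) = (\<Sum>i\<in>J. if i \<in> S then 1 else 0)" for S
          using finite_subset[OF J fin] by (simp add: sum.inter_restrict[symmetric] Int_commute)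
        then have "b 1 = (\<Sum>S\<in>Pow I. -2 * (c S * prod x S) * (\<Sum>i\<in>J. if i \<in> S then 1 else 0))"
          unfolding b_def by (simp add: algebra_simps)
        also have "\<dots> = (\<Sum>S\<in>Pow I. \<Sum>i\<in>J. -2 * ((if i \<in> S then c S else 0) * prod x S))"
          unfolding sum_distrib_left by (intro sum.cong refl) simp
        also have "\<dots> = -2 * (\<Sum>i\<in>J. D i)"
          unfolding D_def walsh_def sum_distrib_left by (rule sum.swap)
        finally show ?thesis .
      qed
      ultimately show ?thesis by (simp add: abs_mult)
    qed
    let ?P = "{i\<in>I. D i \<ge> 0}" and ?N = "{i\<in>I. \<not> D i \<ge> 0}"
    have "(\<Sum>i\<in>I. \<bar>D i\<bar>) = (\<Sum>i\<in>?P. \<bar>D i\<bar>) + (\<Sum>i\<in>?N. \<bar>D i\<bar>)"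
      using fin by (subst sum.union_disjoint[symmetric]) (auto intro!: sum.cong)
    also have "(\<Sum>i\<in>?P. \<bar>D i\<bar>) = (\<Sum>i\<in>?P. D i)" by (intro sum.cong) auto
    also have "(\<Sum>i\<in>?N. \<bar>D i\<bar>) = - (\<Sum>i\<in>?N. D i)"
      unfolding sum_negf[symmetric] by (intro sum.cong) auto
    also have "(\<Sum>i\<in>?P. D i) + - (\<Sum>i\<in>?N. D i) \<le> C * M"
      using flip[of ?P] flip[of ?N] by auto
    finally show ?thesis by (simp add: D_def)
  qed
  then show ?thesis using C(1) by (intro exI[of _ C]) blast
qed

section \<open>The Bohnenblust--Hille inequality on the Boolean cube\<close>

text \<open>
  The product of the \<open>card S\<close> numbers \<open>t\<^sup>2 / g i\<close> and of the single number \<open>\<Prod> g i\<close> does not depend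
  on \<open>g\<close>. The arithmetic-geometric mean inequality for these \<open>card S + 1\<close> numbers produces the
  exponent \<open>2 k / (k + 1)\<close>. The index \<open>None\<close> stands for the additional factor.
\<close>

lemma powr_le_sum_div_plus_prod:
  fixes g :: "'a \<Rightarrow> real"
  assumes "finite S" "\<And>i. i \<in> S \<Longrightarrow> g i > 0" "t \<noteq> 0"
  shows "\<bar>t\<bar> powr (2 * real (card S) / (real (card S) + 1)) \<le> (\<Sum>i\<in>S. t\<^sup>2 / g i) + prod g S"
proof -
  define k where "k = card S"
  define y where "y z = (case z of None \<Rightarrow> prod g S | Some i \<Rightarrow> t\<^sup>2 / g i)" for z
  let ?T = "insert None (Some ` S)"
  have T: "finite ?T" "?T \<noteq> {}" "card ?T = k + 1"
    using assms(1) by (auto simp: k_def card_image)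
  have y0: "y z \<ge> 0" if "z \<in> ?T" for z
  proof -
    have "g i \<ge> 0" if "i \<in> S" for i using assms(2)[OF that] by simp
    then show ?thesis using that by (auto simp: y_def intro!: prod_nonneg)
  qed
  have prod_y: "prod y ?T = (t\<^sup>2) ^ k"
  proof -
    have "prod y ?T = prod g S * (\<Prod>i\<in>S. t\<^sup>2 / g i)"
      using assms(1) by (simp add: prod.reindex y_def)
    moreover have "prod g S \<noteq> 0"
      using assms by (metis less_irrefl prod_zero_iff)
    ultimately show ?thesis by (simp add: prod_dividef k_def)
  qed
  have sum_y: "sum y ?T = (\<Sum>i\<in>S. t\<^sup>2 / g i) + prod g S"
    using assms(1) by (simp add: sum.reindex y_def)
  have "\<bar>t\<bar> powr (2 * real k / (real k + 1)) = prod y ?T powr (1 / card ?T)"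
  proof -
    have "(t\<^sup>2) ^ k = \<bar>t\<bar> powr (2 * real k)"
      using assms(3) powr_realpow[of "\<bar>t\<bar>" "2 * k"] by (simp add: power_mult)
    then show ?thesis using T by (simp add: prod_y powr_powr add.commute)
  qed
  also have "\<dots> \<le> (\<Sum>z\<in>?T. y z / card ?T)"
    by (rule arith_geom_mean[OF T(1,2) y0])
  also have "\<dots> \<le> (\<Sum>z\<in>?T. y z)"
    using y0 T by (intro sum_mono) (auto simp: field_simps mult_le_cancel_left1)
  finally show ?thesis by (simp add: sum_y k_def)
qed

text \<open>
  With \<open>g i\<close> the \<open>\<ell>\<^sup>2\<close> norm of the coefficients of the sets containing \<open>i\<close>, the pointwise
  bound sums up well: \<open>\<Sum>\<^sub>S \<Sum>\<^sub>i a(S)\<^sup>2 / g(i)\<close> over \<open>i \<in> S\<close> collapses to \<open>\<Sum>\<^sub>i g(i)\<close>, and the products sum to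
  at most \<open>\<Prod> (1 + g(i)) \<le> exp (\<Sum> g(i))\<close>. Sets with fewer than \<open>d\<close> elements have a
  smaller exponent \<open>2k/(k+1)\<close>, which is harmless since all coefficients are at most \<open>1\<close>.
\<close>

lemma mixed_norm_bound:
  fixes a :: "'a set \<Rightarrow> real"
  assumes "finite I" "d \<ge> 1"
    and "(\<Sum>i\<in>I. sqrt (\<Sum>S | S \<subseteq> I \<and> i \<in> S. (a S)\<^sup>2)) \<le> 1"
  shows "(\<Sum>S | S \<subseteq> I \<and> S \<noteq> {} \<and> card S \<le> d. \<bar>a S\<bar> powr (2 * real d / (real d + 1))) \<le> 1 + exp 1"
proof -
  define g where "g i = sqrt (\<Sum>S | S \<subseteq> I \<and> i \<in> S. (a S)\<^sup>2)" for i
  have g0: "g i \<ge> 0" for i unfolding g_def by (intro real_sqrt_ge_zero sum_nonneg) auto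
  have g2: "(g i)\<^sup>2 = (\<Sum>S | S \<subseteq> I \<and> i \<in> S. (a S)\<^sup>2)" for i
    unfolding g_def by (intro real_sqrt_pow2 sum_nonneg) auto
  have sum_g: "(\<Sum>i\<in>I. g i) \<le> 1" using assms(3) by (simp add: g_def)
  have finP: "finite {S. S \<subseteq> I \<and> P S}" for P using assms(1) by simp
  have a_le: "\<bar>a S\<bar> \<le> g i" if "S \<subseteq> I" "i \<in> S" for S i
  proof -
    have "(a S)\<^sup>2 \<le> (g i)\<^sup>2"
      unfolding g2 by (rule member_le_sum) (use that finP in auto)
    then show ?thesis using g0 by (simp add: abs_le_square_iff[symmetric])
  qed
  have g_le: "g i \<le> 1" if "i \<in> I" for i
    using member_le_sum[of i I g] that assms(1) g0 sum_g by (auto intro: order_trans)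
  have pointwise: "\<bar>a S\<bar> powr (2 * real d / (real d + 1)) \<le> (\<Sum>i\<in>S. (a S)\<^sup>2 / g i) + prod g S"
    if S: "S \<subseteq> I" "S \<noteq> {}" "card S \<le> d" for S
  proof (cases "a S = 0")
    case True
    then show ?thesis using g0 by (simp add: prod_nonneg)
  next
    case False
    have finS: "finite S" using S assms(1) finite_subset by blast
    obtain i where "i \<in> S" using S by auto
    then have le1: "\<bar>a S\<bar> \<le> 1" using a_le[of S i] g_le[of i] S by force
    have "\<bar>a S\<bar> powr (2 * real d / (real d + 1)) \<le> \<bar>a S\<bar> powr (2 * real (card S) / (real (card S) + 1))"
    proof (rule powr_mono')
      show "2 * real (card S) / (real (card S) + 1) \<le> 2 * real d / (real d + 1)"
        using S(3) by (simp add: divide_simps algebra_simps)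
    qed (use False le1 in auto)
    also have "\<dots> \<le> (\<Sum>i\<in>S. (a S)\<^sup>2 / g i) + prod g S"
    proof (rule powr_le_sum_div_plus_prod[OF finS])
      show "g i > 0" if "i \<in> S" for i using a_le[OF S(1) that] False by simp
    qed (rule False)
    finally show ?thesis .
  qed
  have "(\<Sum>S | S \<subseteq> I \<and> S \<noteq> {} \<and> card S \<le> d. \<bar>a S\<bar> powr (2 * real d / (real d + 1)))
      \<le> (\<Sum>S | S \<subseteq> I \<and> S \<noteq> {} \<and> card S \<le> d. (\<Sum>i\<in>S. (a S)\<^sup>2 / g i) + prod g S)"
    by (intro sum_mono pointwise) auto
  also have "\<dots> \<le> (\<Sum>S\<in>Pow I. (\<Sum>i\<in>S. (a S)\<^sup>2 / g i) + prod g S)"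
    using assms(1) g0 by (intro sum_mono2 add_nonneg_nonneg sum_nonneg prod_nonneg) auto
  also have "\<dots> = (\<Sum>S\<in>Pow I. \<Sum>i\<in>S. (a S)\<^sup>2 / g i) + (\<Sum>S\<in>Pow I. prod g S)"
    by (rule sum.distrib)
  also have "(\<Sum>S\<in>Pow I. \<Sum>i\<in>S. (a S)\<^sup>2 / g i) = (\<Sum>i\<in>I. \<Sum>S | S \<in> Pow I \<and> i \<in> S. (a S)\<^sup>2 / g i)"
  proof -
    have "(\<Sum>S\<in>Pow I. \<Sum>i\<in>S. (a S)\<^sup>2 / g i) = (\<Sum>S\<in>Pow I. \<Sum>i | i \<in> I \<and> i \<in> S. (a S)\<^sup>2 / g i)"
      by (intro sum.cong) auto
    also have "\<dots> = (\<Sum>i\<in>I. \<Sum>S | S \<in> Pow I \<and> i \<in> S. (a S)\<^sup>2 / g i)"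
      by (rule sum.swap_restrict) (use assms(1) in auto)
    finally show ?thesis .
  qed
  also have "\<dots> = (\<Sum>i\<in>I. (g i)\<^sup>2 / g i)"
    by (simp add: g2 sum_divide_distrib)
  also have "\<dots> = (\<Sum>i\<in>I. g i)"
    by (intro sum.cong refl) (simp add: power2_eq_square)
  also have "(\<Sum>S\<in>Pow I. prod g S) = (\<Prod>i\<in>I. g i + 1)"
    by (simp add: prod_add[OF assms(1)])
  also have "\<dots> \<le> (\<Prod>i\<in>I. exp (g i))"
    using g0 by (intro prod_mono) (auto simp: add.commute exp_ge_add_one_self)
  also have "\<dots> = exp (\<Sum>i\<in>I. g i)" by (simp add: exp_sum[OF assms(1)])
  finally show ?thesis using sum_g by (smt (verit) exp_le_cancel_iff)
qed

text \<open>
  By homogeneity the coefficients may be scaled so that \<open>mixed_norm_bound\<close> applies. The sum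
  \<open>\<Sum> g(i)\<close> is at most \<open>3\<^sup>d\<close> times the mean of the total influence.
\<close>

theorem Boolean_Bohnenblust_Hille:
  assumes "d \<ge> 1"
  shows "\<exists>B\<ge>0. \<forall>(I :: 'a set) c M. finite I \<longrightarrow> (\<forall>S\<subseteq>I. d < card S \<longrightarrow> c S = 0) \<longrightarrow>
    (\<forall>y\<in>signs I. \<bar>walsh I c y\<bar> \<le> M) \<longrightarrow>
    (\<Sum>S | S \<subseteq> I \<and> card S \<le> d. \<bar>c S\<bar> powr (2 * real d / (real d + 1)))
      powr ((real d + 1) / (2 * real d)) \<le> B * M"
proof -
  obtain C where C0: "C \<ge> 0 \<and> (\<forall>(I :: 'a set) c M. \<forall>x\<in>signs I. finite I \<longrightarrow>
      (\<forall>S\<subseteq>I. d < card S \<longrightarrow> c S = 0) \<longrightarrow> (\<forall>y\<in>signs I. \<bar>walsh I c y\<bar> \<le> M) \<longrightarrow>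
      (\<Sum>i\<in>I. \<bar>walsh I (\<lambda>S. if i \<in> S then c S else 0) x\<bar>) \<le> C * M)"
    using total_influence_bound[OF assms, where ?'a = 'a] by (elim exE)
  note C = conjunct1[OF C0] conjunct2[OF C0, rule_format]
  define p where "p = 2 * real d / (real d + 1)"
  have p0: "p > 0" using assms by (simp add: p_def)
  have p_inv: "(real d + 1) / (2 * real d) = 1 / p" by (simp add: p_def)
  define A where "A = 3 ^ d * C + 1"
  have A1: "A \<ge> 1" using C(1) by (simp add: A_def)
  have "(\<Sum>S | S \<subseteq> I \<and> card S \<le> d. \<bar>c S\<bar> powr p) powr (1 / p) \<le> A * (2 + exp 1) powr (1 / p) * M"
    if fin: "finite I" and deg: "\<forall>S\<subseteq>I. d < card S \<longrightarrow> c S = 0"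
      and bound: "\<forall>y\<in>signs I. \<bar>walsh I c y\<bar> \<le> M"
    for I :: "'a set" and c M
  proof -
    have sq: "(\<Sum>S\<in>Pow I. (c S)\<^sup>2) \<le> M\<^sup>2"
      unfolding walsh_parseval[OF fin, symmetric]
    proof (rule sign_avg_le[OF fin])
      fix y assume "y \<in> signs I"
      then show "(walsh I c y)\<^sup>2 \<le> M\<^sup>2"
        using power_mono[of "\<bar>walsh I c y\<bar>" M 2] bound by simp
    qed
    have M0: "M \<ge> 0"
    proof -
      have "sign_avg I (\<lambda>x. \<bar>walsh I c x\<bar>) \<le> M" by (rule sign_avg_le[OF fin]) (use bound in auto)
      moreover have "sign_avg I (\<lambda>x. \<bar>walsh I c x\<bar>) \<ge> 0" by (rule sign_avg_nonneg) auto
      ultimately show ?thesis by linarith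
    qed
    have c_le: "\<bar>c S\<bar> \<le> M" if "S \<subseteq> I" for S
    proof -
      have "(c S)\<^sup>2 \<le> (\<Sum>S\<in>Pow I. (c S)\<^sup>2)"
        by (rule member_le_sum) (use that fin in auto)
      then show ?thesis using sq M0 abs_le_square_iff[of "c S" M] by simp
    qed
    show ?thesis
    proof (cases "M = 0")
      case True
      then have "c S = 0" if "S \<subseteq> I" for S using c_le[OF that] by simp
      then have "(\<Sum>S | S \<subseteq> I \<and> card S \<le> d. \<bar>c S\<bar> powr p) = 0" by (intro sum.neutral) auto
      then show ?thesis by (simp add: True)
    next
      case False
      define G where "G = A * M"
      have G: "G > 0" "M \<le> G" "3 ^ d * C * M \<le> G"
      proof -
        have "0 \<le> 3 ^ d * C * M" using M0 C(1) by simp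
        then show "G > 0" "M \<le> G" "3 ^ d * C * M \<le> G"
          using False M0 by (simp_all add: G_def A_def distrib_right)
      qed
      define a where "a S = c S / G" for S
      have "(\<Sum>i\<in>I. sqrt (\<Sum>S | S \<subseteq> I \<and> i \<in> S. (c S)\<^sup>2)) \<le> 3 ^ d * C * M"
      proof -
        have "sqrt (\<Sum>S | S \<subseteq> I \<and> i \<in> S. (c S)\<^sup>2)
            \<le> 3 ^ d * sign_avg I (\<lambda>x. \<bar>walsh I (\<lambda>S. if i \<in> S then c S else 0) x\<bar>)" for i
        proof -
          have "(\<Sum>S | S \<subseteq> I \<and> i \<in> S. (c S)\<^sup>2) = (\<Sum>S\<in>Pow I. (if i \<in> S then c S else 0)\<^sup>2)"
            using fin by (intro sum.mono_neutral_cong_left) auto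
          then show ?thesis
            using walsh_L2_le_L1[OF fin, of d "\<lambda>S. if i \<in> S then c S else 0"] deg by auto
        qed
        then have "(\<Sum>i\<in>I. sqrt (\<Sum>S | S \<subseteq> I \<and> i \<in> S. (c S)\<^sup>2))
            \<le> (\<Sum>i\<in>I. 3 ^ d * sign_avg I (\<lambda>x. \<bar>walsh I (\<lambda>S. if i \<in> S then c S else 0) x\<bar>))"
          by (rule sum_mono)
        also have "\<dots> = 3 ^ d * sign_avg I (\<lambda>x. \<Sum>i\<in>I. \<bar>walsh I (\<lambda>S. if i \<in> S then c S else 0) x\<bar>)"
          unfolding sign_avg_def
          by (subst sum.swap) (simp add: sum_distrib_left sum_divide_distrib)
        also have "\<dots> \<le> 3 ^ d * (C * M)"
          using deg bound by (intro mult_left_mono sign_avg_le[OF fin] C(2)) (auto simp: fin)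
        finally show ?thesis by (simp add: mult.assoc)
      qed
      moreover have "sqrt (\<Sum>S | S \<subseteq> I \<and> i \<in> S. (a S)\<^sup>2) = sqrt (\<Sum>S | S \<subseteq> I \<and> i \<in> S. (c S)\<^sup>2) / G" for i
        using G by (simp add: a_def power_divide sum_divide_distrib[symmetric] real_sqrt_divide)
      ultimately have "(\<Sum>i\<in>I. sqrt (\<Sum>S | S \<subseteq> I \<and> i \<in> S. (a S)\<^sup>2)) \<le> 1"
        using G by (simp add: sum_divide_distrib[symmetric])
      from mixed_norm_bound[OF fin assms this]
      have mixed: "(\<Sum>S | S \<subseteq> I \<and> S \<noteq> {} \<and> card S \<le> d. \<bar>a S\<bar> powr p) \<le> 1 + exp 1"
        by (simp add: p_def)
      have c_a: "\<bar>c S\<bar> powr p = G powr p * \<bar>a S\<bar> powr p" for S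
        using G by (simp add: a_def powr_mult[symmetric] abs_mult[symmetric])
      have "{S. S \<subseteq> I \<and> card S \<le> d} = insert {} {S. S \<subseteq> I \<and> S \<noteq> {} \<and> card S \<le> d}" by auto
      then have "(\<Sum>S | S \<subseteq> I \<and> card S \<le> d. \<bar>c S\<bar> powr p)
          = \<bar>c {}\<bar> powr p + (\<Sum>S | S \<subseteq> I \<and> S \<noteq> {} \<and> card S \<le> d. \<bar>c S\<bar> powr p)"
        using fin by simp
      also have "\<dots> \<le> G powr p + G powr p * (1 + exp 1)"
      proof (rule add_mono)
        show "\<bar>c {}\<bar> powr p \<le> G powr p"
          using c_le[of "{}"] G p0 by (intro powr_mono2) auto
        show "(\<Sum>S | S \<subseteq> I \<and> S \<noteq> {} \<and> card S \<le> d. \<bar>c S\<bar> powr p) \<le> G powr p * (1 + exp 1)"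
          unfolding c_a sum_distrib_left[symmetric] by (intro mult_left_mono mixed) auto
      qed
      finally have "(\<Sum>S | S \<subseteq> I \<and> card S \<le> d. \<bar>c S\<bar> powr p) \<le> G powr p * (2 + exp 1)"
        by (simp add: algebra_simps)
      then have "(\<Sum>S | S \<subseteq> I \<and> card S \<le> d. \<bar>c S\<bar> powr p) powr (1 / p)
          \<le> (G powr p * (2 + exp 1)) powr (1 / p)"
        using p0 by (intro powr_mono2) (auto intro!: sum_nonneg)
      also have "\<dots> = G * (2 + exp 1) powr (1 / p)"
        using G p0 by (simp add: powr_mult powr_powr add_nonneg_nonneg)
      finally show ?thesis by (simp add: G_def algebra_simps)
    qed
  qed
  then show ?thesis
    using A1 by (intro exI[of _ "A * (2 + exp 1) powr (1 / p)"]) (auto simp: p_def)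
qed

section \<open>The Bohnenblust--Hille constant of the cube\<close>

lemma cube_coeff_eq:
  assumes "\<And>x. x \<in> cube N \<Longrightarrow> f x = walsh {..<N} c x" "S \<subseteq> {..<N}"
  shows "cube_coeff N f S = c S"
proof -
  have "cube_coeff N f = restrict c (Pow {..<N})"
    unfolding cube_coeff_def
  proof (rule the_equality)
    show "restrict c (Pow {..<N}) \<in> extensional (Pow {..<N}) \<and>
      (\<forall>x\<in>cube N. f x = (\<Sum>S\<in>Pow {..<N}. restrict c (Pow {..<N}) S * (\<Prod>j\<in>S. x j)))"
      using assms(1) by (simp add: walsh_def)
  next
    fix c' assume c': "c' \<in> extensional (Pow {..<N}) \<and>
      (\<forall>x\<in>cube N. f x = (\<Sum>S\<in>Pow {..<N}. c' S * (\<Prod>j\<in>S. x j)))"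
    have "c' S - c S = 0" if "S \<subseteq> {..<N}" for S
    proof (rule walsh_eq_0_imp_coeff_0[of "{..<N}" "\<lambda>S. c' S - c S"])
      fix x assume "x \<in> signs {..<N}"
      then have "x \<in> cube N" by (simp add: cube_def signs_def)
      then show "walsh {..<N} (\<lambda>S. c' S - c S) x = 0"
        using c' assms(1)[of x] by (simp add: walsh_diff) (simp add: walsh_def)
    qed (use that in auto)
    then show "c' = restrict c (Pow {..<N})"
      using c' by (intro extensionalityI[of _ "Pow {..<N}"]) auto
  qed
  then show ?thesis using assms(2) by simp
qed

lemma cube_expansion:
  assumes "x \<in> cube N"
  shows "f x = walsh {..<N} (cube_coeff N f) x"
proof -
  obtain c where c: "\<forall>x\<in>signs {..<N}. f x = walsh {..<N} c x"
    using walsh_expansion_exists[of "{..<N}" f] by auto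
  then have "cube_coeff N f S = c S" if "S \<subseteq> {..<N}" for S
    using that by (intro cube_coeff_eq) (auto simp: signs_def cube_def)
  then have "walsh {..<N} (cube_coeff N f) x = walsh {..<N} c x"
    unfolding walsh_def by (intro sum.cong) auto
  then show ?thesis using c assms by (simp add: cube_def signs_def)
qed

lemma finite_cube: "finite (cube N)"
  unfolding cube_def by (rule finite_PiE) auto

lemma cube_nonempty: "cube N \<noteq> {}"
  by (simp add: cube_def PiE_eq_empty_iff)

lemma abs_le_cube_sup_norm: "x \<in> cube N \<Longrightarrow> \<bar>f x\<bar> \<le> cube_sup_norm N f"
  unfolding cube_sup_norm_def by (rule cSUP_upper) (auto simp: finite_cube)

lemma is_BH_cube_bound_exists:
  assumes "d \<ge> 1"
  shows "\<exists>C. is_BH_cube_bound d C"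
proof -
  obtain B where B0: "B \<ge> 0 \<and> (\<forall>(I :: nat set) c M. finite I \<longrightarrow> (\<forall>S\<subseteq>I. d < card S \<longrightarrow> c S = 0) \<longrightarrow>
    (\<forall>y\<in>signs I. \<bar>walsh I c y\<bar> \<le> M) \<longrightarrow>
    (\<Sum>S | S \<subseteq> I \<and> card S \<le> d. \<bar>c S\<bar> powr (2 * real d / (real d + 1)))
      powr ((real d + 1) / (2 * real d)) \<le> B * M)"
    using Boolean_Bohnenblust_Hille[OF assms, where ?'a = nat] by (elim exE)
  note B = conjunct2[OF B0, rule_format]
  have "is_BH_cube_bound d B"
    unfolding is_BH_cube_bound_def
  proof (intro allI impI)
    fix N f
    assume deg: "cube_degree_le N d f"
    show "(\<Sum>S | S \<subseteq> {..<N} \<and> card S \<le> d. \<bar>cube_coeff N f S\<bar> powr (2 * real d / (real d + 1)))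
      powr ((real d + 1) / (2 * real d)) \<le> B * cube_sup_norm N f"
    proof (rule B)
      show "cube_coeff N f S = 0" if "S \<subseteq> {..<N}" "d < card S" for S
        using deg that by (auto simp: cube_degree_le_def)
      show "\<bar>walsh {..<N} (cube_coeff N f) y\<bar> \<le> cube_sup_norm N f" if "y \<in> signs {..<N}" for y
        using that abs_le_cube_sup_norm[of _ N f] cube_expansion[of _ N f]
        by (auto simp: cube_def signs_def)
    qed simp
  qed
  then show ?thesis ..
qed

text \<open>
  Test with the constant function \<open>1\<close> in one variable.
\<close>

lemma is_BH_cube_bound_ge_1:
  assumes C: "is_BH_cube_bound d C"
  shows "C \<ge> 1"
proof -
  define f :: "(nat \<Rightarrow> real) \<Rightarrow> real" where "f = (\<lambda>_. 1)"
  have coeff: "cube_coeff 1 f S = (if S = {} then 1 else 0)" if "S \<subseteq> {..<1}" for S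
  proof (rule cube_coeff_eq[OF _ that])
    show "f x = walsh {..<1} (\<lambda>S. if S = {} then 1 else 0) x" for x
      by (simp add: f_def walsh_def if_distrib[of "\<lambda>t. t * _"] cong: if_cong)
  qed
  have sup: "cube_sup_norm 1 f = 1"
    unfolding cube_sup_norm_def f_def using cube_nonempty[of 1] by simp
  have eq: "(\<Sum>S | S \<subseteq> {..<1} \<and> card S \<le> d. \<bar>cube_coeff 1 f S\<bar> powr (2 * real d / (real d + 1)))
      = (\<Sum>S | S \<subseteq> {..<1::nat} \<and> card S \<le> d. if S = {} then 1 else 0)"
    by (intro sum.cong) (auto simp: coeff simp del: One_nat_def)
  have "finite {S. S \<subseteq> {..<1::nat} \<and> card S \<le> d}" by simp
  then have eq1: "(\<Sum>S | S \<subseteq> {..<1::nat} \<and> card S \<le> d. if S = {} then 1 else 0) = (1::real)"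
    by (subst sum.delta) auto
  have "cube_degree_le 1 d f"
    unfolding cube_degree_le_def using coeff by auto
  moreover have "f \<in> cube 1 \<rightarrow> {-1..1}" by (auto simp: f_def)
  ultimately have "(\<Sum>S | S \<subseteq> {..<1} \<and> card S \<le> d. \<bar>cube_coeff 1 f S\<bar> powr (2 * real d / (real d + 1)))
      powr ((real d + 1) / (2 * real d)) \<le> C * cube_sup_norm 1 f"
    using C unfolding is_BH_cube_bound_def by blast
  then show ?thesis unfolding eq eq1 sup by simp
qed

lemma BH_cube_ge_1:
  assumes "d \<ge> 1"
  shows "BH_cube d \<ge> 1"
  unfolding BH_cube_def
  by (rule cInf_greatest) (use is_BH_cube_bound_exists[OF assms] is_BH_cube_bound_ge_1 in auto)

text \<open>
  The index set is renamed to an initial segment of the natural numbers. An infimum of admissible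
  constants is admissible because the inequality for a fixed function is closed.
\<close>

lemma BH_cube_walsh:
  fixes c :: "'a set \<Rightarrow> real"
  assumes "d \<ge> 1" "finite I" "I \<noteq> {}" "\<And>S. S \<subseteq> I \<Longrightarrow> d < card S \<Longrightarrow> c S = 0"
    and "\<And>y. y \<in> signs I \<Longrightarrow> \<bar>walsh I c y\<bar> \<le> 1"
  shows "(\<Sum>S | S \<subseteq> I \<and> card S \<le> d. \<bar>c S\<bar> powr (2 * real d / (real d + 1)))
      powr ((real d + 1) / (2 * real d)) \<le> BH_cube d"
proof -
  define N where "N = card I"
  have N: "N \<ge> 1" using assms by (simp add: N_def Suc_le_eq card_gt_0_iff)
  obtain h where h: "bij_betw h I {..<N}"
    using ex_bij_betw_finite_nat[OF assms(2)] by (auto simp: N_def atLeast0LessThan)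
  have inj: "inj_on h I" and img: "h ` I = {..<N}" using h by (auto simp: bij_betw_def)
  define c' where "c' T = c (inv_into I h ` T)" for T
  have c': "c' (h ` S) = c S" if "S \<subseteq> I" for S
    by (simp add: c'_def inv_into_image_cancel[OF inj that])
  have card_h: "card (h ` S) = card S" if "S \<subseteq> I" for S
    using inj that by (meson card_image inj_on_subset)
  have sub: "h ` S \<subseteq> {..<N}" if "S \<subseteq> I" for S using img that by blast
  have Pow_eq: "Pow {..<N} = image h ` Pow I"
    by (simp add: img[symmetric] image_Pow_surj)
  have inj_Pow: "inj_on (image h) (Pow I)" by (rule inj_on_image_Pow[OF inj])
  define f where "f x = walsh {..<N} c' x" for x
  have f_eq: "f x = walsh I c (restrict (\<lambda>i. x (h i)) I)" for x
  proof -
    have "f x = (\<Sum>S\<in>Pow I. c' (h ` S) * prod x (h ` S))"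
      unfolding f_def walsh_def Pow_eq by (simp add: sum.reindex[OF inj_Pow])
    also have "\<dots> = (\<Sum>S\<in>Pow I. c S * prod (restrict (\<lambda>i. x (h i)) I) S)"
    proof (intro sum.cong refl)
      fix S assume "S \<in> Pow I"
      then have S: "S \<subseteq> I" by simp
      have "prod x (h ` S) = (\<Prod>i\<in>S. x (h i))"
        using inj S by (subst prod.reindex) (auto intro: inj_on_subset)
      also have "\<dots> = prod (restrict (\<lambda>i. x (h i)) I) S"
        using S by (intro prod.cong) auto
      finally show "c' (h ` S) * prod x (h ` S) = c S * prod (restrict (\<lambda>i. x (h i)) I) S"
        by (simp add: c'[OF S])
    qed
    finally show ?thesis by (simp add: walsh_def)
  qed
  have f_le: "\<bar>f x\<bar> \<le> 1" if "x \<in> cube N" for x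
    unfolding f_eq
  proof (rule assms(5))
    have "x (h i) \<in> {-1, 1}" if "i \<in> I" for i
      using \<open>x \<in> cube N\<close> img that unfolding cube_def by blast
    then show "restrict (\<lambda>i. x (h i)) I \<in> signs I"
      unfolding signs_def by auto
  qed
  have coeff: "cube_coeff N f T = c' T" if "T \<subseteq> {..<N}" for T
    using that by (intro cube_coeff_eq) (auto simp: f_def)
  have deg: "cube_degree_le N d f"
    unfolding cube_degree_le_def Pow_eq
    using assms(4) card_h c' coeff sub by auto
  have sup: "cube_sup_norm N f \<le> 1"
    unfolding cube_sup_norm_def by (rule cSUP_least[OF cube_nonempty]) (rule f_le)
  have eq: "(\<Sum>S | S \<subseteq> {..<N} \<and> card S \<le> d. \<bar>cube_coeff N f S\<bar> powr (2 * real d / (real d + 1)))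
     = (\<Sum>S | S \<subseteq> I \<and> card S \<le> d. \<bar>c S\<bar> powr (2 * real d / (real d + 1)))" (is "?L = ?R")
  proof -
    have "{S. S \<subseteq> {..<N} \<and> card S \<le> d} = image h ` {S. S \<subseteq> I \<and> card S \<le> d}"
    proof -
      have "{S. S \<subseteq> {..<N} \<and> card S \<le> d} = {S \<in> Pow {..<N}. card S \<le> d}" by auto
      also have "\<dots> = image h ` {S. S \<subseteq> I \<and> card S \<le> d}"
        unfolding Pow_eq using card_h by auto
      finally show ?thesis .
    qed
    then have "?L = (\<Sum>S | S \<subseteq> I \<and> card S \<le> d. \<bar>cube_coeff N f (h ` S)\<bar> powr (2 * real d / (real d + 1)))"
      using inj_Pow by (simp add: sum.reindex inj_on_def)
    also have "\<dots> = ?R"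
      using sub by (intro sum.cong refl) (auto simp: coeff c')
    finally show ?thesis .
  qed
  show ?thesis
    unfolding BH_cube_def
  proof (rule cInf_greatest)
    show "{C. is_BH_cube_bound d C} \<noteq> {}" using is_BH_cube_bound_exists[OF assms(1)] by auto
  next
    fix C assume C: "C \<in> {C. is_BH_cube_bound d C}"
    moreover have "f \<in> cube N \<rightarrow> {-1..1}" using f_le by (auto simp: abs_le_iff)
    ultimately have le: "?R powr ((real d + 1) / (2 * real d)) \<le> C * cube_sup_norm N f"
      using N deg unfolding is_BH_cube_bound_def eq[symmetric] by blast
    moreover have "C \<ge> 1" using C is_BH_cube_bound_ge_1 by auto
    ultimately show "?R powr ((real d + 1) / (2 * real d)) \<le> C"
      using sup mult_left_mono[of "cube_sup_norm N f" 1 C] by linarith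
  qed
qed

section \<open>Quadratic forms and tensor products\<close>

definition quadratic_form :: "nat \<Rightarrow> complex mat \<Rightarrow> (nat \<Rightarrow> complex) \<Rightarrow> complex" where
  "quadratic_form L A u = (\<Sum>a<L. \<Sum>b<L. cnj (u a) * A $$ (a, b) * u b)"

definition norm_sq :: "nat \<Rightarrow> (nat \<Rightarrow> complex) \<Rightarrow> real" where
  "norm_sq L u = (\<Sum>a<L. (cmod (u a))\<^sup>2)"

text \<open>
  Without a bound on the set, its supremum in the reals would carry no information.
\<close>

lemma bdd_above_op_norm:
  "bdd_above ((\<lambda>v. l2_norm_vec (A *\<^sub>v v)) ` {v \<in> carrier_vec (dim_col A). l2_norm_vec v \<le> 1})"
proof (rule bdd_aboveI2)
  fix v assume v: "v \<in> {v \<in> carrier_vec (dim_col A). l2_norm_vec v \<le> 1}"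
  have v_le: "cmod (v $ j) \<le> 1" if "j < dim_col A" for j
  proof -
    have "(cmod (v $ j))\<^sup>2 \<le> (\<Sum>i<dim_vec v. (cmod (v $ i))\<^sup>2)"
      by (rule member_le_sum) (use v that in auto)
    also have "\<dots> \<le> 1" using v by (simp add: l2_norm_vec_def)
    finally show ?thesis by (simp add: abs_square_le_1)
  qed
  have "cmod ((A *\<^sub>v v) $ i) \<le> (\<Sum>j<dim_col A. cmod (A $$ (i, j)))" if "i < dim_row A" for i
  proof -
    have "(A *\<^sub>v v) $ i = (\<Sum>j<dim_col A. A $$ (i, j) * v $ j)"
      using that v by (auto simp: scalar_prod_def atLeast0LessThan intro!: sum.cong)
    also have "cmod \<dots> \<le> (\<Sum>j<dim_col A. cmod (A $$ (i, j)) * 1)"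
      unfolding norm_mult[symmetric] 
      by (rule sum_norm_le) (use v_le in \<open>auto simp: norm_mult intro!: mult_left_le\<close>)
    finally show ?thesis by simp
  qed
  then show "l2_norm_vec (A *\<^sub>v v) \<le> sqrt (\<Sum>i<dim_row A. (\<Sum>j<dim_col A. cmod (A $$ (i, j)))\<^sup>2)"
    by (auto simp: l2_norm_vec_def intro!: sum_mono power_mono)
qed

lemma quadratic_form_le_op_norm:
  assumes "A \<in> carrier_mat L L" "norm_sq L u = 1"
  shows "cmod (quadratic_form L A u) \<le> op_norm_mat A"
proof -
  define v where "v = vec L u"
  have v: "v \<in> {v \<in> carrier_vec (dim_col A). l2_norm_vec v \<le> 1}"
    using assms by (auto simp: v_def l2_norm_vec_def norm_sq_def)
  have Av: "(A *\<^sub>v v) $ a = (\<Sum>b<L. A $$ (a, b) * u b)" if "a < L" for a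
    using that assms(1) by (auto simp: v_def scalar_prod_def atLeast0LessThan intro!: sum.cong)
  have "quadratic_form L A u = (\<Sum>a<L. cnj (u a) * (A *\<^sub>v v) $ a)"
    unfolding quadratic_form_def by (intro sum.cong refl) (simp add: Av sum_distrib_left mult.assoc)
  also have "cmod \<dots> \<le> (\<Sum>a<L. cmod (u a) * cmod ((A *\<^sub>v v) $ a))"
    by (rule sum_norm_le) (simp add: norm_mult)
  also have "\<dots> \<le> sqrt ((\<Sum>a<L. (cmod (u a))\<^sup>2) * (\<Sum>a<L. (cmod ((A *\<^sub>v v) $ a))\<^sup>2))"
    by (intro real_le_rsqrt Cauchy_Schwarz_ineq_sum)
  also have "\<dots> = l2_norm_vec (A *\<^sub>v v)"
    using assms by (simp add: norm_sq_def l2_norm_vec_def)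
  also have "\<dots> \<le> op_norm_mat A"
    unfolding op_norm_mat_def by (rule cSUP_upper[OF v bdd_above_op_norm])
  finally show ?thesis .
qed

lemma hermitian_mat_index:
  assumes "hermitian_mat A" "A \<in> carrier_mat L L" "a < L" "b < L"
  shows "cnj (A $$ (a, b)) = A $$ (b, a)"
proof -
  have "mat_adjoint A $$ (b, a) = conjugate (col A b) $ a"
    using assms unfolding mat_adjoint_def by (subst mat_of_rows_index) auto
  then have "mat_adjoint A $$ (b, a) = cnj (A $$ (a, b))"
    using assms by simp
  then show ?thesis using assms(1) by (simp add: hermitian_mat_def)
qed

lemma quadratic_form_hermitian:
  assumes "hermitian_mat A" "A \<in> carrier_mat L L"
  shows "Im (quadratic_form L A u) = 0"
proof -
  have "cnj (quadratic_form L A u) = (\<Sum>a<L. \<Sum>b<L. cnj (u b) * A $$ (b, a) * u a)"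
    unfolding quadratic_form_def cnj_sum
    by (intro sum.cong refl) (use hermitian_mat_index[OF assms] in simp)
  also have "\<dots> = quadratic_form L A u"
    unfolding quadratic_form_def by (rule sum.swap)
  finally show ?thesis by (metis cnj.simps(2) equal_neg_zero)
qed

text \<open>
  The tensor product of vectors, with indices arranged as in the Kronecker product of matrices.
\<close>

fun tensor_vec :: "nat \<Rightarrow> (nat \<Rightarrow> complex) list \<Rightarrow> nat \<Rightarrow> complex" where
  "tensor_vec K [] p = 1"
| "tensor_vec K (u # us) p = u (p div K ^ length us) * tensor_vec K us (p mod K ^ length us)"

lemma sum_div_mod:
  fixes F :: "nat \<Rightarrow> nat \<Rightarrow> 'a::comm_monoid_add"
  shows "(\<Sum>p<K * L. F (p div L) (p mod L)) = (\<Sum>a<K. \<Sum>b<L. F a b)"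
proof (cases "L = 0")
  case False
  have "(\<Sum>p<K * L. F (p div L) (p mod L)) = (\<Sum>(a, b)\<in>{..<K} \<times> {..<L}. F a b)"
  proof (rule sum.reindex_bij_witness[of _ "\<lambda>(a, b). a * L + b" "\<lambda>p. (p div L, p mod L)"])
    fix z assume "z \<in> {..<K} \<times> {..<L}"
    then obtain a b where z: "z = (a, b)" "a < K" "b < L" by auto
    have "a * L + b < (a + 1) * L" using z by simp
    also have "\<dots> \<le> K * L" using z by (intro mult_right_mono) auto
    finally show "(case z of (a, b) \<Rightarrow> a * L + b) \<in> {..<K * L}" using z by simp
  qed (use False in \<open>auto simp: less_mult_imp_div_less\<close>)
  then show ?thesis by (simp add: sum.cartesian_product)
qed simp

lemma kronecker_list_carrier:
  "set As \<subseteq> carrier_mat K K \<Longrightarrow> kronecker_list As \<in> carrier_mat (K ^ length As) (K ^ length As)"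
  by (induction As) (auto simp: kronecker_list_def kronecker_def)

lemma kronecker_list_Cons_index:
  assumes "A \<in> carrier_mat K K" "set As \<subseteq> carrier_mat K K"
    and "p < K * K ^ length As" "q < K * K ^ length As"
  shows "kronecker_list (A # As) $$ (p, q)
    = A $$ (p div K ^ length As, q div K ^ length As)
      * kronecker_list As $$ (p mod K ^ length As, q mod K ^ length As)"
proof -
  have "kronecker_list (A # As) = A \<otimes>\<^sub>K kronecker_list As" by (simp add: kronecker_list_def)
  then show ?thesis
    using assms kronecker_list_carrier[OF assms(2)] by (simp add: kronecker_def)
qed

lemma quadratic_form_tensor:
  assumes "length As = length us" "set As \<subseteq> carrier_mat K K"
  shows "quadratic_form (K ^ length As) (kronecker_list As) (tensor_vec K us)
    = (\<Prod>j<length As. quadratic_form K (As ! j) (us ! j))"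
  using assms
proof (induction As us rule: list_induct2)
  case Nil
  then show ?case by (simp add: quadratic_form_def kronecker_list_def)
next
  case (Cons A As u us)
  define L where "L = K ^ length us"
  define U where "U = tensor_vec K us"
  define B where "B = kronecker_list As"
  let ?f = "\<lambda>a b. cnj (u a) * A $$ (a, b) * u b"
  let ?g = "\<lambda>c d. cnj (U c) * B $$ (c, d) * U d"
  have "quadratic_form (K ^ length (A # As)) (kronecker_list (A # As)) (tensor_vec K (u # us))
    = (\<Sum>p<K * L. \<Sum>q<K * L. ?f (p div L) (q div L) * ?g (p mod L) (q mod L))"
  proof -
    have "kronecker_list (A # As) $$ (p, q) = A $$ (p div L, q div L) * B $$ (p mod L, q mod L)"
      if "p < K * L" "q < K * L" for p q
      using kronecker_list_Cons_index[of A K As p q] that Cons.hyps Cons.prems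
      by (simp add: L_def B_def)
    moreover have "tensor_vec K (u # us) p = u (p div L) * U (p mod L)" for p
      by (simp add: L_def U_def)
    moreover have "K ^ length (A # As) = K * L" using Cons.hyps by (simp add: L_def)
    ultimately show ?thesis
      unfolding quadratic_form_def by (intro sum.cong) (simp_all add: mult_ac)
  qed
  also have "\<dots> = (\<Sum>p<K * L. \<Sum>b<K. \<Sum>d<L. ?f (p div L) b * ?g (p mod L) d)"
    by (intro sum.cong refl sum_div_mod)
  also have "\<dots> = (\<Sum>a<K. \<Sum>c<L. \<Sum>b<K. \<Sum>d<L. ?f a b * ?g c d)"
    by (rule sum_div_mod)
  also have "\<dots> = quadratic_form K A u * quadratic_form L B U"
    unfolding quadratic_form_def sum_product ..
  also have "quadratic_form L B U = (\<Prod>j<length As. quadratic_form K (As ! j) (us ! j))"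
    using Cons.IH Cons.prems Cons.hyps by (simp add: L_def B_def U_def)
  finally have "quadratic_form (K ^ length (A # As)) (kronecker_list (A # As)) (tensor_vec K (u # us))
    = quadratic_form K A u * (\<Prod>j<length As. quadratic_form K (As ! j) (us ! j))" .
  then show ?case
    unfolding list.size add_0_right add_Suc_right prod.lessThan_Suc_shift
    by (simp del: tensor_vec.simps)
qed

lemma norm_sq_tensor:
  "norm_sq (K ^ length us) (tensor_vec K us) = (\<Prod>j<length us. norm_sq K (us ! j))"
proof (induction us)
  case Nil
  then show ?case by (simp add: norm_sq_def)
next
  case (Cons u us)
  define L where "L = K ^ length us"
  have "norm_sq (K ^ length (u # us)) (tensor_vec K (u # us))
     = (\<Sum>p<K * L. (cmod (u (p div L)))\<^sup>2 * (cmod (tensor_vec K us (p mod L)))\<^sup>2)"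
    by (simp add: norm_sq_def L_def norm_mult power_mult_distrib)
  also have "\<dots> = (\<Sum>a<K. \<Sum>b<L. (cmod (u a))\<^sup>2 * (cmod (tensor_vec K us b))\<^sup>2)"
    by (rule sum_div_mod)
  also have "\<dots> = norm_sq K u * norm_sq L (tensor_vec K us)"
    unfolding norm_sq_def sum_product ..
  also have "norm_sq L (tensor_vec K us) = (\<Prod>j<length us. norm_sq K (us ! j))"
    unfolding L_def by (rule Cons.IH)
  finally have "norm_sq (K ^ length (u # us)) (tensor_vec K (u # us))
    = norm_sq K u * (\<Prod>j<length us. norm_sq K (us ! j))" .
  then show ?case
    unfolding list.size add_0_right add_Suc_right prod.lessThan_Suc_shift
    by (simp del: tensor_vec.simps)
qed

text \<open>
  Pairs \<open>j < k\<close> are summed with the larger index outside, which suits induction on \<open>K\<close>.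
\<close>

lemma sum_gm_indices:
  "(\<Sum>r\<in>gm_indices K. F r) = F GM_I + (\<Sum>k<K. \<Sum>j<k. F (GM_A j k)) + (\<Sum>k<K. \<Sum>j<k. F (GM_B j k))
     + (\<Sum>m\<in>{1..<K}. F (GM_C m))"
proof -
  let ?P = "SIGMA k:{..<K}. {..<k}"
  let ?A = "(\<lambda>(k, j). GM_A j k) ` ?P" and ?B = "(\<lambda>(k, j). GM_B j k) ` ?P" and ?C = "GM_C ` {1..<K}"
  have "gm_indices K = (({GM_I} \<union> ?A) \<union> ?B) \<union> ?C"
    unfolding gm_indices_def by (force simp: image_iff)
  then have "(\<Sum>r\<in>gm_indices K. F r) = (\<Sum>r\<in>{GM_I}. F r) + (\<Sum>r\<in>?A. F r) + (\<Sum>r\<in>?B. F r) + (\<Sum>r\<in>?C. F r)"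
  proof -
    assume eq: "gm_indices K = (({GM_I} \<union> ?A) \<union> ?B) \<union> ?C"
    have fin: "finite ?A" "finite ?B" "finite ?C" by simp_all
    have "sum F (gm_indices K) = sum F (({GM_I} \<union> ?A) \<union> ?B) + sum F ?C"
      unfolding eq by (rule sum.union_disjoint) (use fin in auto)
    also have "sum F (({GM_I} \<union> ?A) \<union> ?B) = sum F ({GM_I} \<union> ?A) + sum F ?B"
      by (rule sum.union_disjoint) (use fin in auto)
    also have "sum F ({GM_I} \<union> ?A) = sum F {GM_I} + sum F ?A"
      by (rule sum.union_disjoint) (use fin in auto)
    finally show ?thesis .
  qed
  moreover have "(\<Sum>r\<in>?A. F r) = (\<Sum>k<K. \<Sum>j<k. F (GM_A j k))"
    by (subst sum.reindex) (auto simp: inj_on_def sum.Sigma case_prod_unfold)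
  moreover have "(\<Sum>r\<in>?B. F r) = (\<Sum>k<K. \<Sum>j<k. F (GM_B j k))"
    by (subst sum.reindex) (auto simp: inj_on_def sum.Sigma case_prod_unfold)
  moreover have "(\<Sum>r\<in>?C. F r) = (\<Sum>m\<in>{1..<K}. F (GM_C m))"
    by (subst sum.reindex) (auto simp: inj_on_def)
  ultimately show ?thesis by simp
qed

lemma finite_gm_indices: "finite (gm_indices K)"
proof -
  have "gm_indices K \<subseteq> {GM_I} \<union> (\<lambda>(j, k). GM_A j k) ` ({..<K} \<times> {..<K})
      \<union> (\<lambda>(j, k). GM_B j k) ` ({..<K} \<times> {..<K}) \<union> GM_C ` {..<K}"
    unfolding gm_indices_def by (force simp: image_iff)
  then show ?thesis by (rule finite_subset) auto
qed

lemma finite_gm_words: "finite (gm_words K n)"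
  unfolding gm_words_def by (rule finite_lists_length_eq[OF finite_gm_indices])

lemma sum_gm_words_Suc:
  "(\<Sum>\<alpha>\<in>gm_words K (Suc n). F \<alpha>) = (\<Sum>r\<in>gm_indices K. \<Sum>\<alpha>\<in>gm_words K n. F (r # \<alpha>))"
proof -
  have "gm_words K (Suc n) = (\<lambda>(r, \<alpha>). r # \<alpha>) ` (gm_indices K \<times> gm_words K n)"
    unfolding gm_words_def by (force simp: length_Suc_conv image_iff)
  then show ?thesis
    by (simp add: sum.reindex inj_on_def sum.cartesian_product case_prod_unfold)
qed

text \<open>
  Distributivity: words are choices of one index per site, so averages over product states factorize.
\<close>

lemma sum_gm_words_prod:
  fixes F :: "nat \<Rightarrow> gm_index \<Rightarrow> 'a::comm_semiring_1"
  shows "(\<Sum>\<alpha>\<in>gm_words K n. \<Prod>j<n. F j (\<alpha> ! j)) = (\<Prod>j<n. \<Sum>r\<in>gm_indices K. F j r)"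
proof (induction n arbitrary: F)
  case 0
  have "gm_words K 0 = {[]}" by (auto simp: gm_words_def)
  then show ?case by simp
next
  case (Suc n)
  have "(\<Sum>\<alpha>\<in>gm_words K (Suc n). \<Prod>j<Suc n. F j (\<alpha> ! j))
    = (\<Sum>r\<in>gm_indices K. \<Sum>\<alpha>\<in>gm_words K n. F 0 r * (\<Prod>j<n. F (Suc j) (\<alpha> ! j)))"
    unfolding sum_gm_words_Suc by (simp add: prod.lessThan_Suc_shift del: prod.lessThan_Suc)
  also have "\<dots> = (\<Sum>r\<in>gm_indices K. F 0 r) * (\<Prod>j<n. \<Sum>r\<in>gm_indices K. F (Suc j) r)"
    unfolding Suc.IH[symmetric] sum_product ..
  finally show ?case
    by (simp add: prod.lessThan_Suc_shift del: prod.lessThan_Suc)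
qed

section \<open>Completeness of the Gell-Mann basis\<close>

text \<open>
  The \<open>m\<close>-th diagonal Gell-Mann matrix has the entries \<open>diag_norm K m * diag_pattern m i\<close>.
\<close>

definition diag_pattern :: "nat \<Rightarrow> nat \<Rightarrow> real" where
  "diag_pattern m i = (if i < m then 1 else if i = m then - real m else 0)"

definition diag_norm :: "nat \<Rightarrow> nat \<Rightarrow> real" where
  "diag_norm K m = sqrt (real K / real (m\<^sup>2 + m))"

lemma gm_matrix_carrier: "gm_matrix K r \<in> carrier_mat K K"
  by (cases r) (auto simp: matrix_unit_def)

lemma gm_I_index: "i < K \<Longrightarrow> j < K \<Longrightarrow> gm_matrix K GM_I $$ (i, j) = (if i = j then 1 else 0)"
  by simp

lemma matrix_unit_carrier: "matrix_unit K x y \<in> carrier_mat K K"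
  by (simp add: matrix_unit_def)

lemma matrix_unit_index:
  "i < K \<Longrightarrow> j < K \<Longrightarrow> matrix_unit K x y $$ (i, j) = (if i = x \<and> j = y then 1 else 0)"
  by (simp add: matrix_unit_def)

lemma gm_A_index:
  assumes "i < K" "j < K"
  shows "gm_matrix K (GM_A x y) $$ (i, j)
    = complex_of_real (sqrt (real K / 2)) * ((if i = x \<and> j = y then 1 else 0) + (if i = y \<and> j = x then 1 else 0))"
proof -
  have "gm_matrix K (GM_A x y) $$ (i, j)
    = complex_of_real (sqrt (real K / 2)) * (matrix_unit K x y $$ (i, j) + matrix_unit K y x $$ (i, j))"
    using assms matrix_unit_carrier[of K x y] matrix_unit_carrier[of K y x] by simp
  then show ?thesis by (simp only: matrix_unit_index[OF assms])
qed

lemma gm_B_index: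
  assumes "i < K" "j < K"
  shows "gm_matrix K (GM_B x y) $$ (i, j)
    = complex_of_real (sqrt (real K / 2)) * ((if i = x \<and> j = y then - \<i> else 0) + (if i = y \<and> j = x then \<i> else 0))"
proof -
  have "gm_matrix K (GM_B x y) $$ (i, j)
    = complex_of_real (sqrt (real K / 2)) * (- \<i> * matrix_unit K x y $$ (i, j) + \<i> * matrix_unit K y x $$ (i, j))"
    using assms matrix_unit_carrier[of K x y] matrix_unit_carrier[of K y x] by simp
  then show ?thesis
    unfolding matrix_unit_index[OF assms] if_distrib[of "\<lambda>z. _ * z"] mult_zero_right mult_1_right .
qed

lemma gm_C_index:
  assumes "i < K" "j < K"
  shows "gm_matrix K (GM_C m) $$ (i, j) = (if i = j then complex_of_real (diag_norm K m * diag_pattern m i) else 0)"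
proof -
  have "(\<Sum>k<m. matrix_unit K k k $$ (i, j)) = (\<Sum>k<m. if k = i then (if i = j then 1 else 0) else 0)"
    using assms by (intro sum.cong) (auto simp: matrix_unit_def)
  also have "\<dots> = (if i < m \<and> i = j then 1 else 0)" by simp
  finally show ?thesis
    using assms by (auto simp: diag_norm_def diag_pattern_def) (auto simp: matrix_unit_def)
qed

text \<open>
  Terms with \<open>m < k\<close> vanish, and for \<open>m > k\<close> the sum telescopes, since
  \<open>1/(m\<^sup>2 + m) = 1/m - 1/(m + 1)\<close>. So the induction on \<open>N\<close> starts right after \<open>k\<close>.
\<close>

lemma diag_pattern_completeness:
  assumes "i \<le> k" "k < N"
  shows "(\<Sum>m\<in>{1..<N}. diag_pattern m i * diag_pattern m k / (real m ^ 2 + real m))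
    = (if i = k then 1 else 0) - 1 / real N"
proof -
  have "Suc k \<le> N" using assms by simp
  then show ?thesis
  proof (induction N rule: nat_induct_at_least)
    case base
    show ?case
    proof (cases "k = 0")
      case False
      have "(\<Sum>m\<in>{1..<Suc k}. diag_pattern m i * diag_pattern m k / (real m ^ 2 + real m))
         = diag_pattern k i * diag_pattern k k / (real k ^ 2 + real k)"
        using False by (simp add: diag_pattern_def)
      moreover have "real k ^ 2 + real k = real k * (real k + 1)"
        by (simp add: power2_eq_square algebra_simps)
      moreover have "real k + real k * real k > 0"
        using False by (intro add_pos_pos mult_pos_pos) auto
      ultimately show ?thesis
        using False assms by (auto simp: diag_pattern_def field_simps)
    qed (use assms in simp)
  next
    case (Suc N)
    then have "diag_pattern N i = 1" "diag_pattern N k = 1" "N \<ge> 1"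
      using assms by (auto simp: diag_pattern_def)
    moreover have "1 / (real N ^ 2 + real N) = 1 / real N - 1 / real (Suc N)"
      using \<open>N \<ge> 1\<close> by (simp add: power2_eq_square field_simps)
    ultimately show ?case
      using Suc by simp
  qed
qed

lemma diag_pattern_sum:
  assumes "m < K"
  shows "(\<Sum>i<K. diag_pattern m i * h i) = (\<Sum>i<m. h i) - real m * h m"
proof -
  have "(\<Sum>i<K. diag_pattern m i * h i) = (\<Sum>i<Suc m. diag_pattern m i * h i)"
    by (rule sum.mono_neutral_right) (use assms in \<open>auto simp: diag_pattern_def\<close>)
  then show ?thesis by (simp add: diag_pattern_def)
qed

lemma diag_pattern_sum_0: "m < K \<Longrightarrow> (\<Sum>i<K. diag_pattern m i) = 0"
  using diag_pattern_sum[of m K "\<lambda>_. 1"] by simp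

text \<open>
  The pattern with the smaller index has sum zero, and the other one is constant on its support.
\<close>

lemma diag_pattern_orthogonal:
  assumes "m < K" "l < K" 
  shows "(\<Sum>i<K. diag_pattern m i * diag_pattern l i) = (if m = l then real m ^ 2 + real m else 0)"
proof -
  have less: "(\<Sum>i<K. diag_pattern m i * diag_pattern l i) = 0" if "m < l" "l < K" for m l
    using that by (subst diag_pattern_sum) (auto simp: diag_pattern_def)
  have eq: "(\<Sum>i<K. diag_pattern m i * diag_pattern m i) = real m ^ 2 + real m"
    using assms by (subst diag_pattern_sum) (auto simp: diag_pattern_def power2_eq_square)
  show ?thesis
    using less[of m l] less[of l m] eq assms by (cases m l rule: linorder_cases) (auto simp: mult.commute)
qed

lemma diag_norm_sq: "m \<ge> 1 \<Longrightarrow> diag_norm K m * diag_norm K m = real K / (real m ^ 2 + real m)"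
  by (simp add: diag_norm_def)

lemma sum_pairs_delta:
  fixes c :: "'a::comm_monoid_add" and a b K :: nat
  assumes "a < b" "b < K"
  shows "(\<Sum>k<K. \<Sum>j<k. if j = a \<and> k = b then c else 0) = c"
proof -
  have "(\<Sum>k<K. \<Sum>j<k. if j = a \<and> k = b then c else 0) = (\<Sum>k<K. if k = b then c else 0)"
  proof (intro sum.cong refl)
    fix k 
    have "(\<Sum>j<k. if j = a \<and> k = b then c else 0) = (\<Sum>j<k. if j = a then (if k = b then c else 0) else 0)"
      by (intro sum.cong) auto
    also have "\<dots> = (if k = b then c else 0)"
      using assms by auto
    finally show "(\<Sum>j<k. if j = a \<and> k = b then c else 0) = (if k = b then c else 0)" .
  qed
  then show ?thesis using assms by simp
qed

text \<open>
  The symmetric and antisymmetric matrices together resolve the off-diagonal matrix units, the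
  identity and the diagonal matrices resolve the diagonal ones.
\<close>

lemma gm_completeness:
  assumes "i < K" "j < K" "k < K" "l < K"
  shows "(\<Sum>r\<in>gm_indices K. gm_matrix K r $$ (i, j) * cnj (gm_matrix K r $$ (k, l)))
    = (if i = k \<and> j = l then of_nat K else 0)"
proof -
  let ?s = "complex_of_real (sqrt (real K / 2))"
  have s2: "?s * ?s = of_nat K / 2" 
    by (simp add: of_real_mult[symmetric] del: of_real_mult)
  have s3: "?s * a * cnj (?s * b) = of_nat K / 2 * (a * cnj b)" for a b
  proof -
    have "?s * a * cnj (?s * b) = ?s * ?s * (a * cnj b)" by simp
    then show ?thesis unfolding s2 .
  qed
  have AB: "(\<Sum>y<K. \<Sum>x<y. gm_matrix K (GM_A x y) $$ (i, j) * cnj (gm_matrix K (GM_A x y) $$ (k, l)))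
      + (\<Sum>y<K. \<Sum>x<y. gm_matrix K (GM_B x y) $$ (i, j) * cnj (gm_matrix K (GM_B x y) $$ (k, l)))
      = (if i = k \<and> j = l \<and> i \<noteq> j then of_nat K else 0)" (is "?S1 + ?S2 = _")
  proof -
    have pt: "gm_matrix K (GM_A x y) $$ (i, j) * cnj (gm_matrix K (GM_A x y) $$ (k, l))
        + gm_matrix K (GM_B x y) $$ (i, j) * cnj (gm_matrix K (GM_B x y) $$ (k, l))
        = (if x = min i j \<and> y = max i j then (if i = k \<and> j = l then of_nat K else 0) else 0)"
      if "x < y" for x y
    proof -
      have A: "gm_matrix K (GM_A x y) $$ (i, j) * cnj (gm_matrix K (GM_A x y) $$ (k, l))
        = of_nat K / 2 * (((if i = x \<and> j = y then 1 else 0) + (if i = y \<and> j = x then 1 else 0))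
           * ((if k = x \<and> l = y then 1 else 0) + (if k = y \<and> l = x then 1 else 0)))"
        unfolding gm_A_index[OF assms(1,2)] gm_A_index[OF assms(3,4)] s3
        by (simp add: if_distrib[of cnj] cong: if_cong)
      have B: "gm_matrix K (GM_B x y) $$ (i, j) * cnj (gm_matrix K (GM_B x y) $$ (k, l))
        = of_nat K / 2 * (((if i = x \<and> j = y then - \<i> else 0) + (if i = y \<and> j = x then \<i> else 0))
           * ((if k = x \<and> l = y then \<i> else 0) + (if k = y \<and> l = x then - \<i> else 0)))"
        unfolding gm_B_index[OF assms(1,2)] gm_B_index[OF assms(3,4)] s3
        by (simp add: if_distrib[of cnj] cong: if_cong)
      \<comment> \<open>The symmetric and the antisymmetric contribution agree if the two index pairs coincide and
        cancel if they are swapped.\<close>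
      have bool: "of_nat K / 2 * (((if p then 1 else 0) + (if q then 1 else 0)) * ((if r then 1 else 0) + (if t then 1 else 0)))
          + of_nat K / 2 * (((if p then - \<i> else 0) + (if q then \<i> else 0)) * ((if r then \<i> else 0) + (if t then - \<i> else 0)))
          = (if p \<and> r \<or> q \<and> t then complex_of_nat K else 0)"
        if "\<not> (p \<and> q)" "\<not> (r \<and> t)" for p q r t
        using that by (cases p; cases q; cases r; cases t) simp_all
      have "(i = x \<and> j = y) \<and> (k = x \<and> l = y) \<or> (i = y \<and> j = x) \<and> (k = y \<and> l = x)
          \<longleftrightarrow> (x = min i j \<and> y = max i j) \<and> (i = k \<and> j = l)"
        using that by (auto simp: min_def max_def)
      then show ?thesis unfolding A B using that by (subst bool) auto
    qed
    have "?S1 + ?S2 = (\<Sum>y<K. \<Sum>x<y. if x = min i j \<and> y = max i j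
        then (if i = k \<and> j = l then of_nat K else 0) else 0)"
      unfolding sum.distrib[symmetric] by (intro sum.cong refl pt) auto
    also have "\<dots> = (if i = k \<and> j = l \<and> i \<noteq> j then of_nat K else 0)"
    proof (cases "i = j")
      case True
      then have "(\<Sum>y<K. \<Sum>x<y. if x = min i j \<and> y = max i j
        then (if i = k \<and> j = l then of_nat K else 0) else 0) = (0::complex)"
        by (intro sum.neutral ballI) auto
      then show ?thesis using True by simp
    next
      case False
      then have "min i j < max i j" "max i j < K" using assms by auto
      then show ?thesis using False by (subst sum_pairs_delta) auto
    qed
    finally show ?thesis .
  qed
  have C: "gm_matrix K GM_I $$ (i, j) * cnj (gm_matrix K GM_I $$ (k, l))
      + (\<Sum>m\<in>{1..<K}. gm_matrix K (GM_C m) $$ (i, j) * cnj (gm_matrix K (GM_C m) $$ (k, l)))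
      = (if i = k \<and> j = l \<and> i = j then of_nat K else 0)"
  proof (cases "i = j \<and> k = l")
    case True
    have comp: "1 + (\<Sum>m\<in>{1..<K}. (diag_norm K m * diag_pattern m i) * (diag_norm K m * diag_pattern m k))
        = (if i = k then real K else 0)"
    proof -
      have "(\<Sum>m\<in>{1..<K}. (diag_norm K m * diag_pattern m i) * (diag_norm K m * diag_pattern m k))
        = real K * (\<Sum>m\<in>{1..<K}. diag_pattern m (min i k) * diag_pattern m (max i k) / (real m ^ 2 + real m))"
        unfolding sum_distrib_left
      proof (intro sum.cong refl)
        fix m assume "m \<in> {1..<K}"
        then have dn: "diag_norm K m * diag_norm K m = real K / (real m ^ 2 + real m)"
          by (intro diag_norm_sq) simp
        have "(diag_norm K m * diag_pattern m i) * (diag_norm K m * diag_pattern m k)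
          = real K / (real m ^ 2 + real m) * (diag_pattern m i * diag_pattern m k)"
          unfolding dn[symmetric] by (simp only: mult_ac)
        then show "(diag_norm K m * diag_pattern m i) * (diag_norm K m * diag_pattern m k)
          = real K * (diag_pattern m (min i k) * diag_pattern m (max i k) / (real m ^ 2 + real m))"
          by (auto simp: min_def max_def mult.commute)
      qed
      also have "\<dots> = real K * ((if i = k then 1 else 0) - 1 / real K)"
        using assms by (subst diag_pattern_completeness) (auto simp: min_def max_def)
      also have "\<dots> = (if i = k then real K else 0) - 1"
        using assms by (simp add: right_diff_distrib)
      finally show ?thesis by simp
    qed
    have "gm_matrix K GM_I $$ (i, j) * cnj (gm_matrix K GM_I $$ (k, l))
      + (\<Sum>m\<in>{1..<K}. gm_matrix K (GM_C m) $$ (i, j) * cnj (gm_matrix K (GM_C m) $$ (k, l)))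
      = of_real (1 + (\<Sum>m\<in>{1..<K}. (diag_norm K m * diag_pattern m i) * (diag_norm K m * diag_pattern m k)))"
      using assms True by (simp add: gm_I_index gm_C_index del: gm_matrix.simps)
    then show ?thesis unfolding comp using True by auto
  qed (use assms in \<open>auto simp: gm_I_index gm_C_index simp del: gm_matrix.simps\<close>)
  have "(\<Sum>r\<in>gm_indices K. gm_matrix K r $$ (i, j) * cnj (gm_matrix K r $$ (k, l)))
    = (if i = k \<and> j = l \<and> i \<noteq> j then of_nat K else 0) + (if i = k \<and> j = l \<and> i = j then of_nat K else 0)"
    unfolding sum_gm_indices AB[symmetric] C[symmetric] by (simp only: add.assoc add.commute add.left_commute)
  then show ?thesis by auto
qed

lemma gm_tensor_Cons_index:
  assumes "\<alpha> \<in> gm_words K n" "p < K * K ^ n" "q < K * K ^ n"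
  shows "gm_tensor K (r # \<alpha>) $$ (p, q)
    = gm_matrix K r $$ (p div K ^ n, q div K ^ n) * gm_tensor K \<alpha> $$ (p mod K ^ n, q mod K ^ n)"
  using assms kronecker_list_Cons_index[of "gm_matrix K r" K "map (gm_matrix K) \<alpha>" p q] gm_matrix_carrier
  by (auto simp: gm_words_def gm_tensor_def)

text \<open>
  Completeness at one site multiplies up over the sites.
\<close>

lemma gm_tensor_completeness:
  assumes "p < K ^ n" "q < K ^ n" "p' < K ^ n" "q' < K ^ n"
  shows "(\<Sum>\<alpha>\<in>gm_words K n. gm_tensor K \<alpha> $$ (p, q) * cnj (gm_tensor K \<alpha> $$ (p', q')))
    = (if p = p' \<and> q = q' then of_nat (K ^ n) else 0)"
  using assms
proof (induction n arbitrary: p q p' q')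
  case 0
  have "gm_words K 0 = {[]}" by (auto simp: gm_words_def)
  then show ?case using 0 by (simp add: gm_tensor_def kronecker_list_def)
next
  case (Suc n)
  define L where "L = K ^ n"
  have L: "L > 0" using Suc.prems(1) by (cases "K = 0") (auto simp: L_def)
  have lt: "p < K * L" "q < K * L" "p' < K * L" "q' < K * L"
    using Suc.prems by (auto simp: L_def)
  have "(\<Sum>\<alpha>\<in>gm_words K (Suc n). gm_tensor K \<alpha> $$ (p, q) * cnj (gm_tensor K \<alpha> $$ (p', q')))
    = (\<Sum>r\<in>gm_indices K. \<Sum>\<alpha>\<in>gm_words K n.
        (gm_matrix K r $$ (p div L, q div L) * cnj (gm_matrix K r $$ (p' div L, q' div L)))
        * (gm_tensor K \<alpha> $$ (p mod L, q mod L) * cnj (gm_tensor K \<alpha> $$ (p' mod L, q' mod L))))"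
    unfolding sum_gm_words_Suc
  proof (intro sum.cong refl)
    fix r \<alpha> assume "\<alpha> \<in> gm_words K n"
    note index = gm_tensor_Cons_index[OF this, folded L_def]
    show "gm_tensor K (r # \<alpha>) $$ (p, q) * cnj (gm_tensor K (r # \<alpha>) $$ (p', q'))
      = (gm_matrix K r $$ (p div L, q div L) * cnj (gm_matrix K r $$ (p' div L, q' div L)))
        * (gm_tensor K \<alpha> $$ (p mod L, q mod L) * cnj (gm_tensor K \<alpha> $$ (p' mod L, q' mod L)))"
      unfolding index[OF lt(1,2)] index[OF lt(3,4)] complex_cnj_mult by (simp only: mult_ac)
  qed
  also have "\<dots> = (\<Sum>r\<in>gm_indices K. gm_matrix K r $$ (p div L, q div L) * cnj (gm_matrix K r $$ (p' div L, q' div L)))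
     * (\<Sum>\<alpha>\<in>gm_words K n. gm_tensor K \<alpha> $$ (p mod L, q mod L) * cnj (gm_tensor K \<alpha> $$ (p' mod L, q' mod L)))"
    unfolding sum_product ..
  also have "\<dots> = (if p div L = p' div L \<and> q div L = q' div L then of_nat K else 0)
      * (if p mod L = p' mod L \<and> q mod L = q' mod L then of_nat L else 0)"
  proof -
    have "(\<Sum>\<alpha>\<in>gm_words K n. gm_tensor K \<alpha> $$ (p mod L, q mod L) * cnj (gm_tensor K \<alpha> $$ (p' mod L, q' mod L)))
      = (if p mod L = p' mod L \<and> q mod L = q' mod L then of_nat L else 0)"
      unfolding L_def by (rule Suc.IH) (use L in \<open>simp_all add: L_def\<close>)
    moreover have "(\<Sum>r\<in>gm_indices K. gm_matrix K r $$ (p div L, q div L) * cnj (gm_matrix K r $$ (p' div L, q' div L)))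
      = (if p div L = p' div L \<and> q div L = q' div L then of_nat K else 0)"
      by (rule gm_completeness) (use lt in \<open>simp_all add: less_mult_imp_div_less\<close>)
    ultimately show ?thesis by (simp only:)
  qed
  also have "\<dots> = (if p = p' \<and> q = q' then of_nat (K ^ Suc n) else 0)"
  proof -
    have split: "x = y \<longleftrightarrow> x div L = y div L \<and> x mod L = y mod L" for x y
      by (metis div_mult_mod_eq)
    show ?thesis unfolding split[of p p'] split[of q q'] by (simp add: L_def)
  qed
  finally show ?case .
qed

text \<open>
  The coefficients are the normalized inner products with the basis matrices.
\<close>

lemma gm_expansion_exists:
  assumes "A \<in> carrier_mat (K ^ n) (K ^ n)" "K \<ge> 1"
  shows "\<exists>c. A = mat (K ^ n) (K ^ n) (\<lambda>p. \<Sum>\<alpha>\<in>gm_words K n. c \<alpha> * gm_tensor K \<alpha> $$ p)"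
proof -
  define L where "L = K ^ n"
  have L: "L \<noteq> 0" using assms(2) by (simp add: L_def)
  define c where "c \<alpha> = (\<Sum>p<L. \<Sum>q<L. cnj (gm_tensor K \<alpha> $$ (p, q)) * A $$ (p, q)) / of_nat L" for \<alpha>
  have "A $$ (p, q) = (\<Sum>\<alpha>\<in>gm_words K n. c \<alpha> * gm_tensor K \<alpha> $$ (p, q))" if "p < L" "q < L" for p q
  proof -
    have "(\<Sum>\<alpha>\<in>gm_words K n. c \<alpha> * gm_tensor K \<alpha> $$ (p, q))
      = (\<Sum>\<alpha>\<in>gm_words K n. \<Sum>p'<L. \<Sum>q'<L.
           (gm_tensor K \<alpha> $$ (p, q) * cnj (gm_tensor K \<alpha> $$ (p', q'))) * (A $$ (p', q') / of_nat L))"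
      unfolding c_def sum_divide_distrib sum_distrib_right by (intro sum.cong refl) simp
    also have "\<dots> = (\<Sum>p'<L. \<Sum>q'<L. \<Sum>\<alpha>\<in>gm_words K n.
           (gm_tensor K \<alpha> $$ (p, q) * cnj (gm_tensor K \<alpha> $$ (p', q'))) * (A $$ (p', q') / of_nat L))"
      by (subst sum.swap, intro sum.cong refl, rule sum.swap)
    also have "\<dots> = (\<Sum>p'<L. \<Sum>q'<L. if p' = p then (if q' = q then A $$ (p', q') else 0) else 0)"
    proof (intro sum.cong refl)
      fix p' q' assume "p' \<in> {..<L}" "q' \<in> {..<L}"
      then show "(\<Sum>\<alpha>\<in>gm_words K n. (gm_tensor K \<alpha> $$ (p, q) * cnj (gm_tensor K \<alpha> $$ (p', q'))) * (A $$ (p', q') / of_nat L))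
        = (if p' = p then (if q' = q then A $$ (p', q') else 0) else 0)"
        unfolding sum_distrib_right[symmetric] using that L
        by (subst gm_tensor_completeness) (auto simp: L_def)
    qed
    also have "\<dots> = (\<Sum>p'<L. if p' = p then (\<Sum>q'<L. if q' = q then A $$ (p', q') else 0) else 0)"
      by (intro sum.cong) auto
    also have "\<dots> = A $$ (p, q)" using that by simp
    finally show ?thesis ..
  qed
  then have "A = mat (K ^ n) (K ^ n) (\<lambda>p. \<Sum>\<alpha>\<in>gm_words K n. c \<alpha> * gm_tensor K \<alpha> $$ p)"
    using assms(1) by (intro eq_matI) (auto simp: L_def)
  then show ?thesis by (rule exI[of _ c])
qed

section \<open>States of one site indexed by signs\<close>

definition state_scale :: "nat \<Rightarrow> real" where
  "state_scale K = 3 / 2 * ((real K)\<^sup>2 - real K)"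

text \<open>
  The Gell-Mann indices serve as labels of the pure states in the mixture. The label of an off-diagonal
  matrix stands for its eigenvector in the span of \<open>e\<^sub>j\<close> and \<open>e\<^sub>k\<close> selected by the sign. The labels
  \<open>GM_I\<close> and \<open>GM_C m\<close> stand for the basis vectors \<open>e\<^sub>0\<close> and \<open>e\<^sub>m\<close>, so together they run through
  all basis vectors.
\<close>

fun pure_state :: "(gm_index \<Rightarrow> real) \<Rightarrow> gm_index \<Rightarrow> nat \<Rightarrow> complex" where
  "pure_state w GM_I a = (if a = 0 then 1 else 0)"
| "pure_state w (GM_A j k) a = complex_of_real (1 / sqrt 2) *
     (if a = j then 1 else if a = k then complex_of_real (w (GM_A j k)) else 0)"
| "pure_state w (GM_B j k) a = complex_of_real (1 / sqrt 2) *
     (if a = j then 1 else if a = k then \<i> * complex_of_real (w (GM_B j k)) else 0)"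
| "pure_state w (GM_C m) a = (if a = m then 1 else 0)"

text \<open>
  The first and the last summand are the diagonal entry of the intended density matrix. The middle
  one removes what the pairs contribute to it: every \<open>i\<close> lies in \<open>K - 1\<close> pairs, and each pair has an
  \<open>A\<close> and a \<open>B\<close> state whose weights \<open>\<surd>(2/K)/s\<close> are shared equally between its two ends. That weight is
  chosen so that the off-diagonal expectations come out as \<open>\<plusminus> 1/s\<close>.
\<close>

definition diag_weight :: "nat \<Rightarrow> (gm_index \<Rightarrow> real) \<Rightarrow> nat \<Rightarrow> real" where
  "diag_weight K w i = 1 / real K - sqrt (2 / real K) / state_scale K * (real K - 1)
     + (\<Sum>m\<in>{1..<K}. w (GM_C m) * (diag_norm K m * diag_pattern m i)) / (state_scale K * real K)"

fun state_weight :: "nat \<Rightarrow> (gm_index \<Rightarrow> real) \<Rightarrow> gm_index \<Rightarrow> real" where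
  "state_weight K w GM_I = diag_weight K w 0"
| "state_weight K w (GM_A j k) = sqrt (2 / real K) / state_scale K"
| "state_weight K w (GM_B j k) = sqrt (2 / real K) / state_scale K"
| "state_weight K w (GM_C m) = diag_weight K w m"

text \<open>
  The expectation of \<open>M\<close> in the mixed state, that is, the trace of \<open>\<rho>(w) M\<close>.
\<close>

definition state_value :: "nat \<Rightarrow> (gm_index \<Rightarrow> real) \<Rightarrow> complex mat \<Rightarrow> complex" where
  "state_value K w M = (\<Sum>r\<in>gm_indices K. complex_of_real (state_weight K w r) * quadratic_form K M (pure_state w r))"

lemma state_scale_ge: "K \<ge> 2 \<Longrightarrow> state_scale K \<ge> 3"
proof -
  assume "K \<ge> 2"
  then have "real K * (real K - 1) \<ge> 2 * 1" by (intro mult_mono) auto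
  then show ?thesis by (simp add: state_scale_def power2_eq_square algebra_simps)
qed

text \<open>
  By completeness, the squares of the diagonal Gell-Mann entries in a fixed row add up to \<open>K - 1\<close>, and there
  are \<open>K - 1\<close> signs; Cauchy--Schwarz then bounds the sum by \<open>K - 1\<close>.
\<close>

lemma diag_row_bound:
  assumes "i < K" "\<And>m. m \<in> {1..<K} \<Longrightarrow> \<bar>w (GM_C m)\<bar> = 1"
  shows "\<bar>\<Sum>m\<in>{1..<K}. w (GM_C m) * (diag_norm K m * diag_pattern m i)\<bar> \<le> real K - 1"
proof -
  have K: "real K > 0" using assms(1) by simp
  have w2: "(\<Sum>m\<in>{1..<K}. (w (GM_C m))\<^sup>2) = real K - 1"
  proof -
    have "(w (GM_C m))\<^sup>2 = 1" if "m \<in> {1..<K}" for m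
      using assms(2)[OF that] by (simp add: power2_eq_1_iff abs_eq_iff')
    then show ?thesis using assms(1) by (simp add: of_nat_diff)
  qed
  have "(\<Sum>m\<in>{1..<K}. (diag_norm K m * diag_pattern m i)\<^sup>2)
      = real K * (\<Sum>m\<in>{1..<K}. diag_pattern m i * diag_pattern m i / (real m ^ 2 + real m))"
    unfolding sum_distrib_left
  proof (intro sum.cong refl)
    fix m assume "m \<in> {1..<K}"
    then have dn: "diag_norm K m * diag_norm K m = real K / (real m ^ 2 + real m)"
      by (intro diag_norm_sq) simp
    have "(diag_norm K m * diag_pattern m i)\<^sup>2 = diag_norm K m * diag_norm K m * (diag_pattern m i * diag_pattern m i)"
      by (simp add: power2_eq_square)
    then show "(diag_norm K m * diag_pattern m i)\<^sup>2
      = real K * (diag_pattern m i * diag_pattern m i / (real m ^ 2 + real m))"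
      unfolding dn by simp
  qed
  also have "\<dots> = real K - 1"
    unfolding diag_pattern_completeness[OF order_refl assms(1)]
    using K by (simp add: right_diff_distrib)
  finally have row: "(\<Sum>m\<in>{1..<K}. (diag_norm K m * diag_pattern m i)\<^sup>2) = real K - 1" .
  have "(\<Sum>m\<in>{1..<K}. w (GM_C m) * (diag_norm K m * diag_pattern m i))\<^sup>2 \<le> (real K - 1)\<^sup>2"
    using Cauchy_Schwarz_ineq_sum[of "\<lambda>m. w (GM_C m)" "\<lambda>m. diag_norm K m * diag_pattern m i" "{1..<K}"]
    unfolding w2 row power2_eq_square[of "real K - 1"] .
  then show ?thesis using assms(1) by (simp add: abs_le_square_iff[symmetric])
qed

text \<open>
  This fixes the size of \<open>s\<close>. Since \<open>(K - 1)/s = 2/(3K)\<close>, the two subtracted quantities are at most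
  \<open>2/(3K)\<close> and \<open>2/(3K\<^sup>2)\<close>, and they do not exceed \<open>1/K\<close> for \<open>K \<ge> 2\<close>.
\<close>

lemma diag_weight_nonneg:
  assumes "K \<ge> 2" "i < K" "\<And>m. m \<in> {1..<K} \<Longrightarrow> \<bar>w (GM_C m)\<bar> = 1"
  shows "diag_weight K w i \<ge> 0"
proof -
  let ?s = "state_scale K"
  let ?k = "real K"
  have k: "?k \<ge> 2" using assms(1) by simp
  have s: "?s > 0" using state_scale_ge[OF assms(1)] by simp
  have sk: "?s = 3 / 2 * ?k * (?k - 1)"
    by (simp add: state_scale_def power2_eq_square algebra_simps)
  have "sqrt (2 / ?k) * ((?k - 1) / ?s) \<le> 1 * ((?k - 1) / ?s)"
    using k s by (intro mult_right_mono) auto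
  also have "\<dots> = 2 / (3 * ?k)" using k unfolding sk by (simp add: field_simps)
  finally have 1: "sqrt (2 / ?k) / ?s * (?k - 1) \<le> 2 / (3 * ?k)" by simp
  have "\<bar>(\<Sum>m\<in>{1..<K}. w (GM_C m) * (diag_norm K m * diag_pattern m i)) / (?s * ?k)\<bar> \<le> (?k - 1) / (?s * ?k)"
    using diag_row_bound[where w = w, OF assms(2,3)] s k by (simp add: abs_mult divide_right_mono)
  also have "\<dots> = 2 / (3 * ?k * ?k)" using k unfolding sk by (simp add: divide_simps)
  finally have 2: "\<bar>(\<Sum>m\<in>{1..<K}. w (GM_C m) * (diag_norm K m * diag_pattern m i)) / (?s * ?k)\<bar>
    \<le> 2 / (3 * ?k * ?k)" .
  have "2 / (3 * ?k) + 2 / (3 * ?k * ?k) \<le> 1 / ?k"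
    using k by (simp add: divide_simps)
  then show ?thesis using 1 2 unfolding diag_weight_def by linarith
qed

lemma state_weight_nonneg:
  assumes "K \<ge> 2" "r \<in> gm_indices K" "\<And>r. r \<in> gm_indices K \<Longrightarrow> \<bar>w r\<bar> = 1"
  shows "state_weight K w r \<ge> 0"
proof -
  have C: "\<bar>w (GM_C m)\<bar> = 1" if "m \<in> {1..<K}" for m
    using that assms(3)[of "GM_C m"] by (simp add: gm_indices_def)
  have s: "state_scale K > 0" using state_scale_ge[OF assms(1)] by simp
  show ?thesis
    using assms(2) diag_weight_nonneg[where w = w, OF assms(1) _ C] s assms(1)
    by (auto simp: gm_indices_def)
qed

lemma norm_sq_pure_state:
  assumes "r \<in> gm_indices K" "\<And>r. r \<in> gm_indices K \<Longrightarrow> \<bar>w r\<bar> = 1" "K \<ge> 1"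
  shows "norm_sq K (pure_state w r) = 1"
proof -
  have pair: "(\<Sum>a<K. if a = j then 1 / 2 else if a = k then 1 / 2 else 0) = (1::real)"
    if "j < k" "k < K" for j k
  proof -
    have "(\<Sum>a<K. if a = j then 1 / 2 else if a = k then 1 / 2 else (0::real))
      = (\<Sum>a<K. (if a = j then 1 / 2 else 0) + (if a = k then 1 / 2 else 0))"
      using that by (intro sum.cong) auto
    then show ?thesis using that by (simp add: sum.distrib)
  qed
  show ?thesis
  proof (cases r)
    case GM_I
    then show ?thesis using assms(3) by (simp add: norm_sq_def if_distrib[of "\<lambda>z. (cmod z)\<^sup>2"] cong: if_cong)
  next
    case (GM_A j k)
    have "(cmod (pure_state w r a))\<^sup>2 = (if a = j then 1 / 2 else if a = k then 1 / 2 else 0)" for a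
      using assms(2)[OF assms(1)] GM_A by (simp add: norm_mult power_mult_distrib norm_divide power_divide)
    then show ?thesis using pair[of j k] assms(1) GM_A by (simp add: norm_sq_def gm_indices_def)
  next
    case (GM_B j k)
    have "(cmod (pure_state w r a))\<^sup>2 = (if a = j then 1 / 2 else if a = k then 1 / 2 else 0)" for a
      using assms(2)[OF assms(1)] GM_B by (simp add: norm_mult power_mult_distrib norm_divide power_divide)
    then show ?thesis using pair[of j k] assms(1) GM_B by (simp add: norm_sq_def gm_indices_def)
  next
    case (GM_C m)
    then show ?thesis using assms(1)
      by (simp add: norm_sq_def gm_indices_def if_distrib[of "\<lambda>z. (cmod z)\<^sup>2"] cong: if_cong)
  qed
qed

lemma quadratic_form_basis:
  assumes "i < K" "\<And>a. u a = (if a = i then 1 else 0)"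
  shows "quadratic_form K M u = M $$ (i, i)"
proof -
  have "quadratic_form K M u = (\<Sum>a\<in>{i}. \<Sum>b<K. cnj (u a) * M $$ (a, b) * u b)"
    unfolding quadratic_form_def by (intro sum.mono_neutral_right) (use assms in auto)
  also have "\<dots> = (\<Sum>a\<in>{i}. \<Sum>b\<in>{i}. cnj (u a) * M $$ (a, b) * u b)"
    by (intro sum.cong refl sum.mono_neutral_right) (use assms in auto)
  finally show ?thesis by (simp add: assms(2))
qed

lemma quadratic_form_two:
  assumes "j < k" "k < K" "\<And>a. a \<noteq> j \<Longrightarrow> a \<noteq> k \<Longrightarrow> u a = 0"
  shows "quadratic_form K M u = cnj (u j) * M $$ (j, j) * u j + cnj (u j) * M $$ (j, k) * u k
    + cnj (u k) * M $$ (k, j) * u j + cnj (u k) * M $$ (k, k) * u k"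
proof -
  have "quadratic_form K M u = (\<Sum>a\<in>{j, k}. \<Sum>b<K. cnj (u a) * M $$ (a, b) * u b)"
    unfolding quadratic_form_def
    by (intro sum.mono_neutral_right) (use assms in auto)
  also have "\<dots> = (\<Sum>a\<in>{j, k}. \<Sum>b\<in>{j, k}. cnj (u a) * M $$ (a, b) * u b)"
    by (intro sum.cong refl sum.mono_neutral_right) (use assms in auto)
  finally show ?thesis using assms by simp
qed

lemma sqrt_half: "complex_of_real (1 / sqrt 2) * complex_of_real (1 / sqrt 2) = 1 / 2"
  by (simp only: of_real_mult[symmetric]) (simp add: real_sqrt_mult_self)

lemma quadratic_form_A:
  assumes "j < k" "k < K" "\<bar>w (GM_A j k)\<bar> = 1"
  shows "quadratic_form K M (pure_state w (GM_A j k)) =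
    1 / 2 * (M $$ (j, j) + M $$ (k, k) + complex_of_real (w (GM_A j k)) * (M $$ (j, k) + M $$ (k, j)))"
proof -
  let ?h = "complex_of_real (1 / sqrt 2)" and ?x = "complex_of_real (w (GM_A j k))"
  have x: "?x * ?x = 1" using assms(3) by (metis abs_mult_self_eq mult_1 of_real_1 of_real_mult)
  have "quadratic_form K M (pure_state w (GM_A j k)) =
    (?h * ?h) * (M $$ (j, j) + (?x * ?x) * M $$ (k, k) + ?x * (M $$ (j, k) + M $$ (k, j)))"
    using assms by (subst quadratic_form_two[OF assms(1,2)]) (auto simp: algebra_simps)
  then show ?thesis unfolding x sqrt_half by simp
qed

lemma quadratic_form_B:
  assumes "j < k" "k < K" "\<bar>w (GM_B j k)\<bar> = 1"
  shows "quadratic_form K M (pure_state w (GM_B j k)) =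
    1 / 2 * (M $$ (j, j) + M $$ (k, k) + \<i> * complex_of_real (w (GM_B j k)) * (M $$ (j, k) - M $$ (k, j)))"
proof -
  let ?h = "complex_of_real (1 / sqrt 2)" and ?x = "complex_of_real (w (GM_B j k))"
  have x: "?x * ?x = 1" using assms(3) by (metis abs_mult_self_eq mult_1 of_real_1 of_real_mult)
  have "quadratic_form K M (pure_state w (GM_B j k)) =
    (?h * ?h) * (M $$ (j, j) + (?x * ?x) * M $$ (k, k) + \<i> * ?x * (M $$ (j, k) - M $$ (k, j)))"
    using assms by (subst quadratic_form_two[OF assms(1,2)]) (auto simp: algebra_simps)
  then show ?thesis unfolding x sqrt_half by simp
qed

lemma sum_pairs_endpoints:
  "(\<Sum>k<K. \<Sum>j<k. D j + D k) = (of_nat K - 1) * (\<Sum>i<K. D i)" for D :: "nat \<Rightarrow> complex"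
  by (induction K) (auto simp: sum.distrib algebra_simps)

text \<open>
  The diagonal contributions of the pairs cancel against the middle summand of \<open>diag_weight\<close>. What
  remains is the trace against \<open>\<rho>(w)\<close>.
\<close>

lemma state_value_eq:
  assumes "K \<ge> 2" "\<And>r. r \<in> gm_indices K \<Longrightarrow> \<bar>w r\<bar> = 1"
  shows "state_value K w M =
    (\<Sum>i<K. complex_of_real (1 / real K + (\<Sum>m\<in>{1..<K}. w (GM_C m) * (diag_norm K m * diag_pattern m i))
        / (state_scale K * real K)) * M $$ (i, i))
    + complex_of_real (sqrt (2 / real K) / (2 * state_scale K)) *
      ((\<Sum>k<K. \<Sum>j<k. complex_of_real (w (GM_A j k)) * (M $$ (j, k) + M $$ (k, j)))
       + (\<Sum>k<K. \<Sum>j<k. \<i> * complex_of_real (w (GM_B j k)) * (M $$ (j, k) - M $$ (k, j))))"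
proof -
  define t where "t = complex_of_real (sqrt (2 / real K) / state_scale K)"
  define D where "D = (\<Sum>i<K. M $$ (i, i))"
  define E where "E i = complex_of_real (1 / real K + (\<Sum>m\<in>{1..<K}. w (GM_C m) * (diag_norm K m * diag_pattern m i))
        / (state_scale K * real K))" for i
  define SA where "SA = (\<Sum>k<K. \<Sum>j<k. complex_of_real (w (GM_A j k)) * (M $$ (j, k) + M $$ (k, j)))"
  define SB where "SB = (\<Sum>k<K. \<Sum>j<k. \<i> * complex_of_real (w (GM_B j k)) * (M $$ (j, k) - M $$ (k, j)))"
  have pairs: "(\<Sum>k<K. \<Sum>j<k. M $$ (j, j) + M $$ (k, k)) = (of_nat K - 1) * D"
    using sum_pairs_endpoints[of "\<lambda>i. M $$ (i, i)" K] by (simp add: D_def)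
  have A: "(\<Sum>k<K. \<Sum>j<k. complex_of_real (state_weight K w (GM_A j k)) * quadratic_form K M (pure_state w (GM_A j k)))
    = t / 2 * ((of_nat K - 1) * D + SA)"
  proof -
    have "(\<Sum>k<K. \<Sum>j<k. complex_of_real (state_weight K w (GM_A j k)) * quadratic_form K M (pure_state w (GM_A j k)))
      = (\<Sum>k<K. \<Sum>j<k. t / 2 * ((M $$ (j, j) + M $$ (k, k)) + complex_of_real (w (GM_A j k)) * (M $$ (j, k) + M $$ (k, j))))"
    proof (intro sum.cong refl)
      fix k j assume "k \<in> {..<K}" "j \<in> {..<k}"
      then have jk: "j < k" "k < K" by auto
      have "\<bar>w (GM_A j k)\<bar> = 1" by (rule assms(2)) (use jk in \<open>simp add: gm_indices_def\<close>)
      then show "complex_of_real (state_weight K w (GM_A j k)) * quadratic_form K M (pure_state w (GM_A j k))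
        = t / 2 * ((M $$ (j, j) + M $$ (k, k)) + complex_of_real (w (GM_A j k)) * (M $$ (j, k) + M $$ (k, j)))"
        unfolding quadratic_form_A[where w = w, OF jk \<open>\<bar>w (GM_A j k)\<bar> = 1\<close>] by (simp add: t_def)
    qed
    also have "\<dots> = t / 2 * ((\<Sum>k<K. \<Sum>j<k. M $$ (j, j) + M $$ (k, k)) + SA)"
      unfolding SA_def sum_distrib_left[symmetric] sum.distrib ..
    finally show ?thesis unfolding pairs .
  qed
  have B: "(\<Sum>k<K. \<Sum>j<k. complex_of_real (state_weight K w (GM_B j k)) * quadratic_form K M (pure_state w (GM_B j k)))
    = t / 2 * ((of_nat K - 1) * D + SB)"
  proof -
    have "(\<Sum>k<K. \<Sum>j<k. complex_of_real (state_weight K w (GM_B j k)) * quadratic_form K M (pure_state w (GM_B j k)))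
      = (\<Sum>k<K. \<Sum>j<k. t / 2 * ((M $$ (j, j) + M $$ (k, k)) + \<i> * complex_of_real (w (GM_B j k)) * (M $$ (j, k) - M $$ (k, j))))"
    proof (intro sum.cong refl)
      fix k j assume "k \<in> {..<K}" "j \<in> {..<k}"
      then have jk: "j < k" "k < K" by auto
      have "\<bar>w (GM_B j k)\<bar> = 1" by (rule assms(2)) (use jk in \<open>simp add: gm_indices_def\<close>)
      then show "complex_of_real (state_weight K w (GM_B j k)) * quadratic_form K M (pure_state w (GM_B j k))
        = t / 2 * ((M $$ (j, j) + M $$ (k, k)) + \<i> * complex_of_real (w (GM_B j k)) * (M $$ (j, k) - M $$ (k, j)))"
        unfolding quadratic_form_B[where w = w, OF jk \<open>\<bar>w (GM_B j k)\<bar> = 1\<close>] by (simp add: t_def)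
    qed
    also have "\<dots> = t / 2 * ((\<Sum>k<K. \<Sum>j<k. M $$ (j, j) + M $$ (k, k)) + SB)"
      unfolding SB_def sum_distrib_left[symmetric] sum.distrib ..
    finally show ?thesis unfolding pairs .
  qed
  have C: "complex_of_real (state_weight K w GM_I) * quadratic_form K M (pure_state w GM_I)
      + (\<Sum>m\<in>{1..<K}. complex_of_real (state_weight K w (GM_C m)) * quadratic_form K M (pure_state w (GM_C m)))
      = (\<Sum>i<K. E i * M $$ (i, i)) - t * (of_nat K - 1) * D"
  proof -
    have "{..<K} = insert 0 {1..<K}" using assms(1) by auto
    then have "(\<Sum>i<K. complex_of_real (diag_weight K w i) * M $$ (i, i))
      = complex_of_real (diag_weight K w 0) * M $$ (0, 0)
       + (\<Sum>m\<in>{1..<K}. complex_of_real (diag_weight K w m) * M $$ (m, m))" by simp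
    moreover have "quadratic_form K M (pure_state w GM_I) = M $$ (0, 0)"
      by (rule quadratic_form_basis) (use assms(1) in auto)
    moreover have "quadratic_form K M (pure_state w (GM_C m)) = M $$ (m, m)" if "m \<in> {1..<K}" for m
      by (rule quadratic_form_basis) (use that in auto)
    ultimately have "complex_of_real (state_weight K w GM_I) * quadratic_form K M (pure_state w GM_I)
      + (\<Sum>m\<in>{1..<K}. complex_of_real (state_weight K w (GM_C m)) * quadratic_form K M (pure_state w (GM_C m)))
      = (\<Sum>i<K. complex_of_real (diag_weight K w i) * M $$ (i, i))" by simp
    also have "\<dots> = (\<Sum>i<K. E i * M $$ (i, i) - t * (of_nat K - 1) * M $$ (i, i))"
      by (intro sum.cong refl) (simp add: diag_weight_def E_def t_def algebra_simps)
    also have "\<dots> = (\<Sum>i<K. E i * M $$ (i, i)) - t * (of_nat K - 1) * D"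
      by (simp add: sum_subtractf sum_distrib_left D_def)
    finally show ?thesis .
  qed
  have "state_value K w M = t / 2 * ((of_nat K - 1) * D + SA) + t / 2 * ((of_nat K - 1) * D + SB)
      + ((\<Sum>i<K. E i * M $$ (i, i)) - t * (of_nat K - 1) * D)"
    unfolding state_value_def sum_gm_indices A B C[symmetric] by (simp only: add_ac)
  also have "\<dots> = (\<Sum>i<K. E i * M $$ (i, i)) + t / 2 * (SA + SB)"
    by (simp add: field_simps)
  also have "t / 2 = complex_of_real (sqrt (2 / real K) / (2 * state_scale K))"
    by (simp add: t_def)
  finally show ?thesis unfolding E_def SA_def SB_def .
qed

text \<open>
  Orthonormality of the Gell-Mann basis picks the sign that belongs to \<open>\<alpha>\<close>.
\<close>

lemma state_value_gm:
  assumes "K \<ge> 2" "\<And>r. r \<in> gm_indices K \<Longrightarrow> \<bar>w r\<bar> = 1" "\<alpha> \<in> gm_indices K"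
  shows "state_value K w (gm_matrix K \<alpha>) = (if \<alpha> = GM_I then 1 else complex_of_real (w \<alpha> / state_scale K))"
proof -
  have K: "real K > 0" using assms(1) by simp
  have sc: "state_scale K > 0" using state_scale_ge[OF assms(1)] by simp
  have half: "sqrt (2 / real K) * sqrt (real K / 2) = 1"
    using K by (simp add: real_sqrt_mult[symmetric])
  define M where "M = gm_matrix K \<alpha>"
  define W where "W i = (\<Sum>m\<in>{1..<K}. w (GM_C m) * (diag_norm K m * diag_pattern m i))" for i
  have val: "state_value K w M =
    (\<Sum>i<K. complex_of_real (1 / real K + W i / (state_scale K * real K)) * M $$ (i, i))
    + complex_of_real (sqrt (2 / real K) / (2 * state_scale K)) *
      ((\<Sum>k<K. \<Sum>j<k. complex_of_real (w (GM_A j k)) * (M $$ (j, k) + M $$ (k, j)))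
       + (\<Sum>k<K. \<Sum>j<k. \<i> * complex_of_real (w (GM_B j k)) * (M $$ (j, k) - M $$ (k, j))))"
    unfolding W_def using assms(1,2) by (rule state_value_eq)
  consider "\<alpha> = GM_I" | a b where "\<alpha> = GM_A a b" "a < b" "b < K" | a b where "\<alpha> = GM_B a b" "a < b" "b < K"
    | l where "\<alpha> = GM_C l" "1 \<le> l" "l < K"
    using assms(3) by (auto simp: gm_indices_def)
  then show ?thesis
  proof cases
    case 1
    have off: "M $$ (j, k) = 0" "M $$ (k, j) = 0" if "j < k" "k < K" for j k
      using that 1 by (simp_all add: M_def)
    have diag: "M $$ (i, i) = 1" if "i < K" for i using that 1 by (simp add: M_def)
    have "(\<Sum>i<K. W i)
      = (\<Sum>m\<in>{1..<K}. w (GM_C m) * diag_norm K m * (\<Sum>i<K. diag_pattern m i))"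
      unfolding W_def by (subst sum.swap) (simp add: sum_distrib_left mult.assoc)
    also have "\<dots> = 0" by (intro sum.neutral ballI) (simp add: diag_pattern_sum_0)
    finally have zero: "(\<Sum>i<K. W i) = 0" .
    have "state_value K w M = (\<Sum>i<K. complex_of_real (1 / real K + W i
        / (state_scale K * real K)))"
      unfolding val by (simp add: off diag)
    also have "\<dots> = complex_of_real ((\<Sum>i<K. 1 / real K) + (\<Sum>i<K. W i)
        / (state_scale K * real K))"
      by (simp only: of_real_sum sum.distrib sum_divide_distrib of_real_add)
    also have "\<dots> = 1" unfolding zero using K by simp
    finally show ?thesis using 1 by (simp add: M_def)
  next
    case (2 a b)
    have diag: "M $$ (i, i) = 0" if "i < K" for i
      using that 2 by (auto simp: M_def gm_A_index simp del: gm_matrix.simps)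
    have sum: "M $$ (j, k) + M $$ (k, j) = (if j = a \<and> k = b then 2 * complex_of_real (sqrt (real K / 2)) else 0)"
      if "j < k" "k < K" for j k
      using that 2 by (auto simp: M_def gm_A_index simp del: gm_matrix.simps)
    have diff: "M $$ (j, k) - M $$ (k, j) = 0" if "j < k" "k < K" for j k
      using that 2 by (auto simp: M_def gm_A_index simp del: gm_matrix.simps)
    have "(\<Sum>k<K. \<Sum>j<k. complex_of_real (w (GM_A j k)) * (M $$ (j, k) + M $$ (k, j)))
      = (\<Sum>k<K. \<Sum>j<k. if j = a \<and> k = b then complex_of_real (w \<alpha>) * (2 * complex_of_real (sqrt (real K / 2))) else 0)"
      by (intro sum.cong refl) (use 2 in \<open>simp add: sum\<close>)
    also have "\<dots> = complex_of_real (w \<alpha> * (2 * sqrt (real K / 2)))"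
      using 2 by (simp add: sum_pairs_delta)
    finally have "state_value K w M = complex_of_real (sqrt (2 / real K) / (2 * state_scale K))
        * complex_of_real (w \<alpha> * (2 * sqrt (real K / 2)))"
      unfolding val by (simp add: diag diff)
    also have "\<dots> = complex_of_real ((sqrt (2 / real K) * sqrt (real K / 2)) * w \<alpha> / state_scale K)"
      unfolding of_real_mult[symmetric] by (simp add: mult_ac)
    finally show ?thesis unfolding half using 2 by (simp add: M_def)
  next
    case (3 a b)
    have diag: "M $$ (i, i) = 0" if "i < K" for i
      using that 3 by (auto simp: M_def gm_B_index simp del: gm_matrix.simps)
    have diff: "M $$ (j, k) - M $$ (k, j) = (if j = a \<and> k = b then - 2 * \<i> * complex_of_real (sqrt (real K / 2)) else 0)"
      if "j < k" "k < K" for j k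
      using that 3 by (auto simp: M_def gm_B_index simp del: gm_matrix.simps)
    have sum: "M $$ (j, k) + M $$ (k, j) = 0" if "j < k" "k < K" for j k
      using that 3 by (auto simp: M_def gm_B_index simp del: gm_matrix.simps)
    have "(\<Sum>k<K. \<Sum>j<k. \<i> * complex_of_real (w (GM_B j k)) * (M $$ (j, k) - M $$ (k, j)))
      = (\<Sum>k<K. \<Sum>j<k. if j = a \<and> k = b then complex_of_real (w \<alpha>) * (2 * complex_of_real (sqrt (real K / 2))) else 0)"
    proof (intro sum.cong refl)
      fix k j assume "k \<in> {..<K}" "j \<in> {..<k}"
      then have D: "M $$ (j, k) - M $$ (k, j) = (if j = a \<and> k = b then - 2 * \<i> * complex_of_real (sqrt (real K / 2)) else 0)"
        by (intro diff) auto
      show "\<i> * complex_of_real (w (GM_B j k)) * (M $$ (j, k) - M $$ (k, j))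
        = (if j = a \<and> k = b then complex_of_real (w \<alpha>) * (2 * complex_of_real (sqrt (real K / 2))) else 0)"
      proof (cases "j = a \<and> k = b")
        case True
        have "\<i> * x * (- 2 * \<i> * y) = x * (2 * y)" for x y :: complex
          by (simp add: complex_eq_iff)
        then show ?thesis unfolding D 3(1) using True by (simp only: if_True simp_thms)
      next
        case False
        then show ?thesis unfolding D by (simp only: if_False mult_zero_right)
      qed
    qed
    also have "\<dots> = complex_of_real (w \<alpha> * (2 * sqrt (real K / 2)))"
      using 3 by (simp add: sum_pairs_delta)
    finally have "state_value K w M = complex_of_real (sqrt (2 / real K) / (2 * state_scale K))
        * complex_of_real (w \<alpha> * (2 * sqrt (real K / 2)))"
      unfolding val by (simp add: diag sum)
    also have "\<dots> = complex_of_real ((sqrt (2 / real K) * sqrt (real K / 2)) * w \<alpha> / state_scale K)"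
      unfolding of_real_mult[symmetric] by (simp add: mult_ac)
    finally show ?thesis unfolding half using 3 by (simp add: M_def)
  next
    case (4 l)
    have off: "M $$ (j, k) = 0" "M $$ (k, j) = 0" if "j < k" "k < K" for j k
      using that 4 by (simp_all add: M_def gm_C_index del: gm_matrix.simps)
    have diag: "M $$ (i, i) = complex_of_real (diag_norm K l * diag_pattern l i)" if "i < K" for i
      using that 4 by (simp add: M_def gm_C_index del: gm_matrix.simps)
    have dn: "diag_norm K l * diag_norm K l * (real l ^ 2 + real l) = real K"
    proof -
      have "real l ^ 2 + real l > 0" using 4 by (intro add_nonneg_pos) auto
      then show ?thesis using 4 by (subst diag_norm_sq) auto
    qed
    have "(\<Sum>i<K. W i * (diag_norm K l * diag_pattern l i))
      = (\<Sum>m\<in>{1..<K}. w (GM_C m) * diag_norm K m * diag_norm K l * (\<Sum>i<K. diag_pattern m i * diag_pattern l i))"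
      unfolding W_def sum_distrib_right sum_distrib_left by (subst sum.swap) (simp add: mult_ac)
    also have "\<dots> = (\<Sum>m\<in>{1..<K}. if m = l then w (GM_C l) * (diag_norm K l * diag_norm K l * (real l ^ 2 + real l)) else 0)"
      by (intro sum.cong refl) (use 4 in \<open>auto simp: diag_pattern_orthogonal\<close>)
    also have "\<dots> = w \<alpha> * real K" unfolding dn using 4 by simp
    finally have orth: "(\<Sum>i<K. W i * (diag_norm K l * diag_pattern l i))
      = w \<alpha> * real K" .
    have zero: "(\<Sum>i<K. diag_norm K l * diag_pattern l i) = 0"
      using 4 by (simp add: sum_distrib_left[symmetric] diag_pattern_sum_0)
    have "state_value K w M = (\<Sum>i<K. complex_of_real (1 / real K + W i
        / (state_scale K * real K)) * complex_of_real (diag_norm K l * diag_pattern l i))"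
      unfolding val by (simp add: off diag)
    also have "\<dots> = complex_of_real ((\<Sum>i<K. diag_norm K l * diag_pattern l i) / real K +
       (\<Sum>i<K. W i * (diag_norm K l * diag_pattern l i))
        / (state_scale K * real K))"
      by (simp only: of_real_mult[symmetric] of_real_sum[symmetric] sum_divide_distrib sum.distrib[symmetric])
         (simp add: distrib_right)
    also have "\<dots> = complex_of_real (w \<alpha> / state_scale K)"
      unfolding zero orth using K by simp
    finally show ?thesis using 4 by (simp add: M_def)
  qed
qed

section \<open>From observables to Boolean functions\<close>

text \<open>
  The constant of the cube is defined through functions with values in the unit interval; homogeneity removes this
  normalization.
\<close>

lemma BH_cube_walsh_scaled:
  fixes c :: "'a set \<Rightarrow> real"
  assumes "d \<ge> 1" "finite I" "I \<noteq> {}" "\<And>S. S \<subseteq> I \<Longrightarrow> d < card S \<Longrightarrow> c S = 0"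
    and bound: "\<And>y. y \<in> signs I \<Longrightarrow> \<bar>walsh I c y\<bar> \<le> M" and "M \<ge> 0"
  shows "(\<Sum>S | S \<subseteq> I \<and> card S \<le> d. \<bar>c S\<bar> powr (2 * real d / (real d + 1)))
      powr ((real d + 1) / (2 * real d)) \<le> BH_cube d * M"
proof (cases "M = 0")
  case True
  have "c S = 0" if "S \<subseteq> I" for S
  proof (rule walsh_eq_0_imp_coeff_0[OF assms(2) _ that])
    show "walsh I c y = 0" if "y \<in> signs I" for y using bound[OF that] True by simp
  qed
  then have "(\<Sum>S | S \<subseteq> I \<and> card S \<le> d. \<bar>c S\<bar> powr (2 * real d / (real d + 1))) = 0"
    by (intro sum.neutral) auto
  then show ?thesis using True by simp
next
  case False
  then have M: "M > 0" using assms(6) by simp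
  define p where "p = 2 * real d / (real d + 1)"
  have p: "p > 0" "(real d + 1) / (2 * real d) = 1 / p" using assms(1) by (simp_all add: p_def)
  define b where "b S = inverse M * c S" for S
  have "(\<Sum>S | S \<subseteq> I \<and> card S \<le> d. \<bar>b S\<bar> powr (2 * real d / (real d + 1)))
      powr ((real d + 1) / (2 * real d)) \<le> BH_cube d"
  proof (rule BH_cube_walsh[OF assms(1-3)])
    show "\<bar>walsh I b y\<bar> \<le> 1" if "y \<in> signs I" for y
      using bound[OF that] M unfolding b_def walsh_scale by (simp add: abs_mult field_simps)
  qed (simp add: b_def assms(4))
  moreover have "\<bar>b S\<bar> powr p = inverse M powr p * \<bar>c S\<bar> powr p" for S
    using M by (simp add: b_def abs_mult powr_mult)
  ultimately have "(inverse M powr p * (\<Sum>S | S \<subseteq> I \<and> card S \<le> d. \<bar>c S\<bar> powr p)) powr (1 / p) \<le> BH_cube d"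
    unfolding p(2) p_def[symmetric] by (simp add: sum_distrib_left)
  moreover have "(inverse M powr p * (\<Sum>S | S \<subseteq> I \<and> card S \<le> d. \<bar>c S\<bar> powr p)) powr (1 / p)
      = inverse M * (\<Sum>S | S \<subseteq> I \<and> card S \<le> d. \<bar>c S\<bar> powr p) powr (1 / p)"
    using M p(1) by (subst powr_mult) (auto simp: powr_powr intro!: sum_nonneg)
  ultimately have "inverse M * (\<Sum>S | S \<subseteq> I \<and> card S \<le> d. \<bar>c S\<bar> powr p) powr (1 / p) \<le> BH_cube d"
    by simp
  then show ?thesis
    unfolding p(2) p_def[symmetric] using M by (simp add: field_simps)
qed

text \<open>
  The expectation of \<open>A\<close> in the product of the mixed states, expanded as a mixture of product vectors.
\<close>

definition product_state_value ::
  "nat \<Rightarrow> nat \<Rightarrow> (nat \<Rightarrow> gm_index \<Rightarrow> real) \<Rightarrow> complex mat \<Rightarrow> complex" where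
  "product_state_value K n w A = (\<Sum>r\<in>gm_words K n.
     complex_of_real (\<Prod>j<n. state_weight K (w j) (r ! j))
     * quadratic_form (K ^ n) A (tensor_vec K (map (\<lambda>j. pure_state (w j) (r ! j)) [0..<n])))"

lemma gm_words_nth: "\<alpha> \<in> gm_words K n \<Longrightarrow> j < n \<Longrightarrow> \<alpha> ! j \<in> gm_indices K"
  by (auto simp: gm_words_def)

lemma quadratic_form_one: "quadratic_form K (1\<^sub>m K) u = complex_of_real (norm_sq K u)"
proof -
  have "(\<Sum>b<K. cnj (u a) * 1\<^sub>m K $$ (a, b) * u b) = complex_of_real ((cmod (u a))\<^sup>2)" if "a < K" for a
  proof -
    have "(\<Sum>b<K. cnj (u a) * 1\<^sub>m K $$ (a, b) * u b) = (\<Sum>b<K. if a = b then cnj (u a) * u b else 0)"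
      using that by (intro sum.cong) auto
    then show ?thesis
      using that by (simp add: complex_norm_square mult.commute del: of_real_power)
  qed
  then show ?thesis by (simp add: quadratic_form_def norm_sq_def)
qed

lemma sum_state_weight:
  assumes "K \<ge> 2" "\<And>r. r \<in> gm_indices K \<Longrightarrow> \<bar>w r\<bar> = 1"
  shows "(\<Sum>r\<in>gm_indices K. state_weight K w r) = 1"
proof -
  have "state_value K w (gm_matrix K GM_I) = complex_of_real (\<Sum>r\<in>gm_indices K. state_weight K w r)"
    using norm_sq_pure_state[where w = w, OF _ assms(2)] assms(1)
    by (simp add: state_value_def quadratic_form_one)
  moreover have "state_value K w (gm_matrix K GM_I) = 1"
    using state_value_gm[where w = w, OF assms, of GM_I] by (simp add: gm_indices_def)
  ultimately show ?thesis by (metis of_real_eq_1_iff)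
qed

text \<open>
  The weights of the product vectors are nonnegative and add up to \<open>1\<close>, and the vectors have norm \<open>1\<close>.
\<close>

lemma product_state_value_le_op_norm:
  assumes "K \<ge> 2" "A \<in> carrier_mat (K ^ n) (K ^ n)"
    and w: "\<And>j r. j < n \<Longrightarrow> r \<in> gm_indices K \<Longrightarrow> \<bar>w j r\<bar> = 1"
  shows "cmod (product_state_value K n w A) \<le> op_norm_mat A"
proof -
  let ?p = "\<lambda>r. \<Prod>j<n. state_weight K (w j) (r ! j)"
  let ?u = "\<lambda>r. tensor_vec K (map (\<lambda>j. pure_state (w j) (r ! j)) [0..<n])"
  have p0: "?p r \<ge> 0" if "r \<in> gm_words K n" for r
  proof (rule prod_nonneg)
    fix j assume "j \<in> {..<n}"
    then show "state_weight K (w j) (r ! j) \<ge> 0"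
      by (intro state_weight_nonneg[OF assms(1)] gm_words_nth[OF that] w) auto
  qed
  have u1: "norm_sq (K ^ n) (?u r) = 1" if "r \<in> gm_words K n" for r
  proof -
    have "norm_sq (K ^ n) (?u r) = (\<Prod>j<n. norm_sq K (pure_state (w j) (r ! j)))"
      using norm_sq_tensor[of K "map (\<lambda>j. pure_state (w j) (r ! j)) [0..<n]"] by simp
    also have "\<dots> = (\<Prod>j<n. 1)"
      by (intro prod.cong refl norm_sq_pure_state gm_words_nth[OF that] w) (use assms(1) in auto)
    finally show ?thesis by simp
  qed
  have "cmod (product_state_value K n w A) \<le> (\<Sum>r\<in>gm_words K n. ?p r * op_norm_mat A)"
    unfolding product_state_value_def
  proof (rule sum_norm_le)
    fix r assume r: "r \<in> gm_words K n"
    have "cmod (quadratic_form (K ^ n) A (?u r)) \<le> op_norm_mat A"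
      by (rule quadratic_form_le_op_norm[OF assms(2) u1[OF r]])
    then show "cmod (complex_of_real (?p r) * quadratic_form (K ^ n) A (?u r)) \<le> ?p r * op_norm_mat A"
      unfolding norm_mult norm_of_real using p0[OF r] by (simp add: mult_left_mono del: of_real_prod)
  qed
  also have "\<dots> = (\<Prod>j<n. \<Sum>r\<in>gm_indices K. state_weight K (w j) r) * op_norm_mat A"
  proof -
    have "(\<Sum>r\<in>gm_words K n. ?p r) = (\<Prod>j<n. \<Sum>r\<in>gm_indices K. state_weight K (w j) r)"
      by (rule sum_gm_words_prod)
    then show ?thesis by (simp only: sum_distrib_right[symmetric])
  qed
  also have "(\<Prod>j<n. \<Sum>r\<in>gm_indices K. state_weight K (w j) r) = (\<Prod>j<n. 1)"
    by (intro prod.cong refl sum_state_weight[OF assms(1)] w) auto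
  finally show ?thesis by simp
qed

lemma product_state_value_hermitian:
  assumes "hermitian_mat A" "A \<in> carrier_mat (K ^ n) (K ^ n)"
  shows "Im (product_state_value K n w A) = 0"
  unfolding product_state_value_def
  by (simp add: Im_sum quadratic_form_hermitian[OF assms] del: of_real_prod)

text \<open>
  Quadratic forms of product vectors factorize over the sites. Averaging each factor separately leaves the
  one-site expectations of the basis matrices.
\<close>

lemma product_state_value_expansion:
  assumes "K \<ge> 2"
    and A: "\<And>p q. p < K ^ n \<Longrightarrow> q < K ^ n \<Longrightarrow> A $$ (p, q) = (\<Sum>\<alpha>\<in>gm_words K n. c \<alpha> * gm_tensor K \<alpha> $$ (p, q))"
    and w: "\<And>j r. j < n \<Longrightarrow> r \<in> gm_indices K \<Longrightarrow> \<bar>w j r\<bar> = 1"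
  shows "product_state_value K n w A = (\<Sum>\<alpha>\<in>gm_words K n. c \<alpha> *
    complex_of_real (\<Prod>j<n. if \<alpha> ! j = GM_I then 1 else w j (\<alpha> ! j) / state_scale K))"
proof -
  let ?p = "\<lambda>r. \<Prod>j<n. complex_of_real (state_weight K (w j) (r ! j))"
  let ?u = "\<lambda>r. tensor_vec K (map (\<lambda>j. pure_state (w j) (r ! j)) [0..<n])"
  let ?q = "\<lambda>\<alpha> r. \<Prod>j<n. quadratic_form K (gm_matrix K (\<alpha> ! j)) (pure_state (w j) (r ! j))"
  have q: "quadratic_form (K ^ n) A (?u r) = (\<Sum>\<alpha>\<in>gm_words K n. c \<alpha> * ?q \<alpha> r)" for r
  proof -
    have "quadratic_form (K ^ n) A (?u r)
      = (\<Sum>p<K ^ n. \<Sum>q<K ^ n. \<Sum>\<alpha>\<in>gm_words K n. c \<alpha> * (cnj (?u r p) * gm_tensor K \<alpha> $$ (p, q) * ?u r q))"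
      unfolding quadratic_form_def
      by (intro sum.cong refl) (simp add: A sum_distrib_left sum_distrib_right mult_ac)
    also have "\<dots> = (\<Sum>p<K ^ n. \<Sum>\<alpha>\<in>gm_words K n. \<Sum>q<K ^ n. c \<alpha> * (cnj (?u r p) * gm_tensor K \<alpha> $$ (p, q) * ?u r q))"
      by (intro sum.cong refl sum.swap)
    also have "\<dots> = (\<Sum>\<alpha>\<in>gm_words K n. \<Sum>p<K ^ n. \<Sum>q<K ^ n. c \<alpha> * (cnj (?u r p) * gm_tensor K \<alpha> $$ (p, q) * ?u r q))"
      by (rule sum.swap)
    also have "\<dots> = (\<Sum>\<alpha>\<in>gm_words K n. c \<alpha> * quadratic_form (K ^ n) (gm_tensor K \<alpha>) (?u r))"
      unfolding quadratic_form_def sum_distrib_left ..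
    also have "\<dots> = (\<Sum>\<alpha>\<in>gm_words K n. c \<alpha> * ?q \<alpha> r)"
    proof (intro sum.cong refl arg_cong2[where f = "(*)"])
      fix \<alpha> assume "\<alpha> \<in> gm_words K n"
      then have len: "length \<alpha> = n" by (simp add: gm_words_def)
      have "quadratic_form (K ^ length (map (gm_matrix K) \<alpha>)) (kronecker_list (map (gm_matrix K) \<alpha>)) (?u r)
        = (\<Prod>j<length (map (gm_matrix K) \<alpha>). quadratic_form K (map (gm_matrix K) \<alpha> ! j)
            (map (\<lambda>j. pure_state (w j) (r ! j)) [0..<n] ! j))"
        by (rule quadratic_form_tensor) (use len gm_matrix_carrier in auto)
      then show "quadratic_form (K ^ n) (gm_tensor K \<alpha>) (?u r) = ?q \<alpha> r"
        using len by (simp add: gm_tensor_def)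
    qed
    finally show ?thesis .
  qed
  have "product_state_value K n w A = (\<Sum>r\<in>gm_words K n. \<Sum>\<alpha>\<in>gm_words K n. c \<alpha> * (?p r * ?q \<alpha> r))"
    unfolding product_state_value_def q sum_distrib_left of_real_prod
    by (intro sum.cong refl) (simp only: mult_ac)
  also have "\<dots> = (\<Sum>\<alpha>\<in>gm_words K n. c \<alpha> * (\<Sum>r\<in>gm_words K n. ?p r * ?q \<alpha> r))"
    unfolding sum_distrib_left by (rule sum.swap)
  also have "\<dots> = (\<Sum>\<alpha>\<in>gm_words K n. c \<alpha> * (\<Prod>j<n. state_value K (w j) (gm_matrix K (\<alpha> ! j))))"
  proof (intro sum.cong refl arg_cong2[where f = "(*)"])
    fix \<alpha>
    show "(\<Sum>r\<in>gm_words K n. ?p r * ?q \<alpha> r) = (\<Prod>j<n. state_value K (w j) (gm_matrix K (\<alpha> ! j)))"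
      unfolding state_value_def prod.distrib[symmetric]
      by (rule sum_gm_words_prod[of "\<lambda>j r. complex_of_real (state_weight K (w j) r)
            * quadratic_form K (gm_matrix K (\<alpha> ! j)) (pure_state (w j) r)"])
  qed
  also have "\<dots> = (\<Sum>\<alpha>\<in>gm_words K n. c \<alpha> *
    complex_of_real (\<Prod>j<n. if \<alpha> ! j = GM_I then 1 else w j (\<alpha> ! j) / state_scale K))"
  proof (intro sum.cong refl arg_cong2[where f = "(*)"])
    fix \<alpha> assume \<alpha>: "\<alpha> \<in> gm_words K n"
    show "(\<Prod>j<n. state_value K (w j) (gm_matrix K (\<alpha> ! j)))
      = complex_of_real (\<Prod>j<n. if \<alpha> ! j = GM_I then 1 else w j (\<alpha> ! j) / state_scale K)"
      unfolding of_real_prod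
    proof (intro prod.cong refl)
      fix j assume "j \<in> {..<n}"
      then have j: "j < n" by simp
      have "state_value K (w j) (gm_matrix K (\<alpha> ! j))
        = (if \<alpha> ! j = GM_I then 1 else complex_of_real (w j (\<alpha> ! j) / state_scale K))"
        by (rule state_value_gm[OF assms(1) w[OF j] gm_words_nth[OF \<alpha> j]])
      then show "state_value K (w j) (gm_matrix K (\<alpha> ! j))
        = complex_of_real (if \<alpha> ! j = GM_I then 1 else w j (\<alpha> ! j) / state_scale K)"
        by simp
    qed
  qed
  finally show ?thesis .
qed

text \<open>
  The Boolean variables: one for each site and each non-identity basis element. A word determines the
  monomial in the variables of its non-identity letters.
\<close>

definition site_vars :: "nat \<Rightarrow> nat \<Rightarrow> (nat \<times> gm_index) set" where
  "site_vars K n = {..<n} \<times> (gm_indices K - {GM_I})"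

definition word_support :: "gm_index list \<Rightarrow> (nat \<times> gm_index) set" where
  "word_support \<alpha> = (\<lambda>j. (j, \<alpha> ! j)) ` {j. j < length \<alpha> \<and> \<alpha> ! j \<noteq> GM_I}"

lemma finite_site_vars: "finite (site_vars K n)"
  by (simp add: site_vars_def finite_gm_indices)

lemma word_support_subset: "\<alpha> \<in> gm_words K n \<Longrightarrow> word_support \<alpha> \<subseteq> site_vars K n"
  by (auto simp: word_support_def site_vars_def gm_words_def)

lemma inj_on_word_support: "inj_on word_support (gm_words K n)"
proof (rule inj_onI)
  fix \<alpha> \<beta> assume \<alpha>: "\<alpha> \<in> gm_words K n" and \<beta>: "\<beta> \<in> gm_words K n" and eq: "word_support \<alpha> = word_support \<beta>"
  have mem: "(j, r) \<in> word_support \<gamma> \<longleftrightarrow> \<gamma> ! j = r \<and> r \<noteq> GM_I" if "\<gamma> \<in> gm_words K n" "j < n" for \<gamma> j r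
    using that by (auto simp: word_support_def gm_words_def)
  show "\<alpha> = \<beta>"
  proof (rule nth_equalityI)
    show "length \<alpha> = length \<beta>" using \<alpha> \<beta> by (simp add: gm_words_def)
    fix j assume "j < length \<alpha>"
    then have "j < n" using \<alpha> by (simp add: gm_words_def)
    then show "\<alpha> ! j = \<beta> ! j" using mem[OF \<alpha>] mem[OF \<beta>] eq by metis
  qed
qed

lemma prod_word_support:
  fixes x :: "nat \<times> gm_index \<Rightarrow> real"
  assumes "\<alpha> \<in> gm_words K n"
  shows "(\<Prod>j<n. if \<alpha> ! j = GM_I then 1 else x (j, \<alpha> ! j) / s)
    = prod x (word_support \<alpha>) / s ^ card (word_support \<alpha>)"
proof -
  let ?J = "{j. j < n \<and> \<alpha> ! j \<noteq> GM_I}"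
  have supp: "word_support \<alpha> = (\<lambda>j. (j, \<alpha> ! j)) ` ?J"
    using assms by (simp add: word_support_def gm_words_def)
  have inj: "inj_on (\<lambda>j. (j, \<alpha> ! j)) ?J" by (auto simp: inj_on_def)
  have "(\<Prod>j<n. if \<alpha> ! j = GM_I then 1 else x (j, \<alpha> ! j) / s) = (\<Prod>j\<in>?J. x (j, \<alpha> ! j) / s)"
    by (rule prod.mono_neutral_cong_right) auto
  also have "\<dots> = (\<Prod>j\<in>?J. x (j, \<alpha> ! j)) / s ^ card ?J"
    by (simp add: prod_dividef)
  finally show ?thesis
    unfolding supp by (simp add: prod.reindex[OF inj] card_image[OF inj])
qed

text \<open>
  The Fourier coefficient of the monomial \<open>S\<close>. At most one word has support \<open>S\<close>, and the sum over such
  words gives the value \<open>0\<close> if there is none.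
\<close>

definition word_coeffs :: "nat \<Rightarrow> nat \<Rightarrow> (gm_index list \<Rightarrow> real) \<Rightarrow> (nat \<times> gm_index) set \<Rightarrow> real" where
  "word_coeffs K n a S = (\<Sum>\<alpha> | \<alpha> \<in> gm_words K n \<and> word_support \<alpha> = S. a \<alpha> / state_scale K ^ card S)"

lemma word_coeffs_support:
  assumes "\<alpha> \<in> gm_words K n"
  shows "word_coeffs K n a (word_support \<alpha>) = a \<alpha> / state_scale K ^ card (word_support \<alpha>)"
proof -
  have "{\<beta>. \<beta> \<in> gm_words K n \<and> word_support \<beta> = word_support \<alpha>} = {\<alpha>}"
    using assms inj_on_word_support[of K n] by (auto simp: inj_on_def)
  then show ?thesis by (simp add: word_coeffs_def)
qed

lemma walsh_word_coeffs:
  "walsh (site_vars K n) (word_coeffs K n a) x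
    = (\<Sum>\<alpha>\<in>gm_words K n. a \<alpha> * (\<Prod>j<n. if \<alpha> ! j = GM_I then 1 else x (j, \<alpha> ! j) / state_scale K))"
proof -
  let ?h = "\<lambda>\<alpha>. a \<alpha> * (prod x (word_support \<alpha>) / state_scale K ^ card (word_support \<alpha>))"
  have "walsh (site_vars K n) (word_coeffs K n a) x
    = (\<Sum>S\<in>Pow (site_vars K n). \<Sum>\<alpha> | \<alpha> \<in> gm_words K n \<and> word_support \<alpha> = S. ?h \<alpha>)"
    unfolding walsh_def word_coeffs_def sum_distrib_right by (intro sum.cong refl) auto
  also have "\<dots> = (\<Sum>\<alpha>\<in>gm_words K n. ?h \<alpha>)"
  proof (rule sum.group)
    show "word_support ` gm_words K n \<subseteq> Pow (site_vars K n)"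
      by (intro image_subsetI PowI word_support_subset)
  qed (simp_all add: finite_gm_words finite_site_vars)
  also have "\<dots> = (\<Sum>\<alpha>\<in>gm_words K n. a \<alpha> * (\<Prod>j<n. if \<alpha> ! j = GM_I then 1 else x (j, \<alpha> ! j) / state_scale K))"
    by (intro sum.cong refl) (simp only: prod_word_support)
  finally show ?thesis .
qed

lemma word_poly_eq_0_imp_coeff_0:
  assumes "K \<ge> 2" "\<And>x. x \<in> signs (site_vars K n) \<Longrightarrow>
      (\<Sum>\<alpha>\<in>gm_words K n. a \<alpha> * (\<Prod>j<n. if \<alpha> ! j = GM_I then 1 else x (j, \<alpha> ! j) / state_scale K)) = 0"
    and \<alpha>: "\<alpha> \<in> gm_words K n"
  shows "a \<alpha> = 0"
proof -
  have "word_coeffs K n a (word_support \<alpha>) = 0"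
    by (rule walsh_eq_0_imp_coeff_0[OF finite_site_vars _ word_support_subset[OF \<alpha>]])
       (simp add: walsh_word_coeffs assms(2))
  then show ?thesis
    using word_coeffs_support[OF \<alpha>, of a] state_scale_ge[OF assms(1)] by simp
qed

text \<open>
  There is no variable for the identity; the sign \<open>1\<close> is a filler that keeps all values of absolute
  value \<open>1\<close>.
\<close>

definition site_signs :: "(nat \<times> gm_index \<Rightarrow> real) \<Rightarrow> nat \<Rightarrow> gm_index \<Rightarrow> real" where
  "site_signs x j r = (if r = GM_I then 1 else x (j, r))"

lemma abs_site_signs:
  assumes "x \<in> signs (site_vars K n)" "j < n" "r \<in> gm_indices K"
  shows "\<bar>site_signs x j r\<bar> = 1"
proof (cases "r = GM_I")
  case False
  then have "x (j, r) \<in> {-1, 1}"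
    using assms unfolding signs_def by (intro PiE_mem[of x "site_vars K n"]) (auto simp: site_vars_def)
  then show ?thesis using False by (auto simp: site_signs_def)
qed (simp add: site_signs_def)

lemma product_state_value_site_signs:
  assumes "K \<ge> 2" "x \<in> signs (site_vars K n)"
    and A: "\<And>p q. p < K ^ n \<Longrightarrow> q < K ^ n \<Longrightarrow> A $$ (p, q) = (\<Sum>\<alpha>\<in>gm_words K n. c \<alpha> * gm_tensor K \<alpha> $$ (p, q))"
  shows "product_state_value K n (site_signs x) A = (\<Sum>\<alpha>\<in>gm_words K n. c \<alpha> *
    complex_of_real (\<Prod>j<n. if \<alpha> ! j = GM_I then 1 else x (j, \<alpha> ! j) / state_scale K))"
proof -
  have "product_state_value K n (site_signs x) A = (\<Sum>\<alpha>\<in>gm_words K n. c \<alpha> *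
    complex_of_real (\<Prod>j<n. if \<alpha> ! j = GM_I then 1 else site_signs x j (\<alpha> ! j) / state_scale K))"
    using assms(1) A abs_site_signs[OF assms(2)] by (rule product_state_value_expansion)
  also have "\<dots> = (\<Sum>\<alpha>\<in>gm_words K n. c \<alpha> *
    complex_of_real (\<Prod>j<n. if \<alpha> ! j = GM_I then 1 else x (j, \<alpha> ! j) / state_scale K))"
    by (intro sum.cong refl arg_cong2[where f = "(*)"] arg_cong[where f = complex_of_real] prod.cong)
       (simp add: site_signs_def)
  finally show ?thesis .
qed

text \<open>
  Two expansions of one matrix have the same expectations in all product states. Their real and
  imaginary parts are Walsh polynomials, and the coefficients of a Walsh polynomial are determined by its values.
\<close>

lemma gm_expansion_unique:
  assumes K: "K \<ge> 2"
    and eq: "\<And>p q. p < K ^ n \<Longrightarrow> q < K ^ n \<Longrightarrow>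
      (\<Sum>\<alpha>\<in>gm_words K n. c \<alpha> * gm_tensor K \<alpha> $$ (p, q)) = (\<Sum>\<alpha>\<in>gm_words K n. c' \<alpha> * gm_tensor K \<alpha> $$ (p, q))"
    and \<alpha>: "\<alpha> \<in> gm_words K n"
  shows "c \<alpha> = c' \<alpha>"
proof -
  let ?R = "\<lambda>x \<alpha>. \<Prod>j<n. if \<alpha> ! j = GM_I then 1 else x (j, \<alpha> ! j) / state_scale K"
  have zero: "(\<Sum>\<alpha>\<in>gm_words K n. (c \<alpha> - c' \<alpha>) * complex_of_real (?R x \<alpha>)) = 0"
    if x: "x \<in> signs (site_vars K n)" for x
  proof -
    have "product_state_value K n (site_signs x) (0\<^sub>m (K ^ n) (K ^ n))
      = (\<Sum>\<alpha>\<in>gm_words K n. (c \<alpha> - c' \<alpha>) * complex_of_real (?R x \<alpha>))"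
      by (rule product_state_value_site_signs[OF K x]) (simp add: left_diff_distrib sum_subtractf eq)
    then show ?thesis by (simp add: product_state_value_def quadratic_form_def)
  qed
  have "Re (c \<alpha> - c' \<alpha>) = 0"
  proof (rule word_poly_eq_0_imp_coeff_0[OF K _ \<alpha>, where a = "\<lambda>\<alpha>. Re (c \<alpha> - c' \<alpha>)"])
    fix x assume "x \<in> signs (site_vars K n)"
    then show "(\<Sum>\<alpha>\<in>gm_words K n. Re (c \<alpha> - c' \<alpha>) * ?R x \<alpha>) = 0"
      using arg_cong[OF zero, of x Re] by (simp add: Re_sum del: of_real_prod)
  qed
  moreover have "Im (c \<alpha> - c' \<alpha>) = 0"
  proof (rule word_poly_eq_0_imp_coeff_0[OF K _ \<alpha>, where a = "\<lambda>\<alpha>. Im (c \<alpha> - c' \<alpha>)"])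
    fix x assume "x \<in> signs (site_vars K n)"
    then show "(\<Sum>\<alpha>\<in>gm_words K n. Im (c \<alpha> - c' \<alpha>) * ?R x \<alpha>) = 0"
      using arg_cong[OF zero, of x Im] by (simp add: Im_sum del: of_real_prod)
  qed
  ultimately show ?thesis by (simp add: complex_eq_iff)
qed

lemma gm_coeff_expansion:
  assumes K: "K \<ge> 2" and A: "A \<in> carrier_mat (K ^ n) (K ^ n)"
    and pq: "p < K ^ n" "q < K ^ n"
  shows "A $$ (p, q) = (\<Sum>\<alpha>\<in>gm_words K n. gm_coeff K n A \<alpha> * gm_tensor K \<alpha> $$ (p, q))"
proof -
  let ?P = "\<lambda>c. c \<in> extensional (gm_words K n) \<and>
     A = mat (K ^ n) (K ^ n) (\<lambda>p. \<Sum>\<alpha>\<in>gm_words K n. c \<alpha> * gm_tensor K \<alpha> $$ p)"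
  obtain c where c: "A = mat (K ^ n) (K ^ n) (\<lambda>p. \<Sum>\<alpha>\<in>gm_words K n. c \<alpha> * gm_tensor K \<alpha> $$ p)"
    using gm_expansion_exists[OF A] K by auto
  have "?P (gm_coeff K n A)"
    unfolding gm_coeff_def
  proof (rule theI[of ?P "restrict c (gm_words K n)"])
    show "?P (restrict c (gm_words K n))"
      using c by simp
  next
    fix c' assume c': "?P c'"
    have "c' \<alpha> = c \<alpha>" if "\<alpha> \<in> gm_words K n" for \<alpha>
    proof (rule gm_expansion_unique[OF K _ that])
      fix p q assume pq: "p < K ^ n" "q < K ^ n"
      have "A $$ (p, q) = (\<Sum>\<alpha>\<in>gm_words K n. c' \<alpha> * gm_tensor K \<alpha> $$ (p, q))"
        by (subst conjunct2[OF c']) (use pq in simp)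
      moreover have "A $$ (p, q) = (\<Sum>\<alpha>\<in>gm_words K n. c \<alpha> * gm_tensor K \<alpha> $$ (p, q))"
        by (subst c) (use pq in simp)
      ultimately show "(\<Sum>\<alpha>\<in>gm_words K n. c' \<alpha> * gm_tensor K \<alpha> $$ (p, q))
        = (\<Sum>\<alpha>\<in>gm_words K n. c \<alpha> * gm_tensor K \<alpha> $$ (p, q))" by simp
    qed
    then show "c' = restrict c (gm_words K n)"
      using c' by (intro extensionalityI[of _ "gm_words K n"]) auto
  qed
  from conjunct2[OF this] show ?thesis
    by (rule ssubst[of A _ "\<lambda>B. B $$ (p, q) = _"]) (use pq in simp)
qed

text \<open>
  In the state with all signs \<open>1\<close>, the identity has expectation \<open>1\<close> and every other basis matrix
  has expectation \<open>1/s < 1\<close>.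
\<close>

lemma gm_matrix_eq_one_iff:
  assumes "K \<ge> 2" "r \<in> gm_indices K"
  shows "gm_matrix K r = 1\<^sub>m K \<longleftrightarrow> r = GM_I"
proof
  assume one: "gm_matrix K r = 1\<^sub>m K"
  show "r = GM_I"
  proof (rule ccontr)
    assume "r \<noteq> GM_I"
    then have "state_value K (\<lambda>_. 1) (gm_matrix K r) = complex_of_real (1 / state_scale K)"
      using state_value_gm[OF assms(1) _ assms(2), of "\<lambda>_. 1"] by simp
    moreover have "state_value K (\<lambda>_. 1) (gm_matrix K r) = 1"
      using state_value_gm[OF assms(1), of "\<lambda>_. 1" GM_I] one by (simp add: gm_indices_def)
    ultimately have "1 / state_scale K = 1" by (metis of_real_eq_1_iff)
    then show False using state_scale_ge[OF assms(1)] by (simp add: divide_simps split: if_splits)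
  qed
qed simp

lemma card_word_support:
  assumes "K \<ge> 2" "\<alpha> \<in> gm_words K n"
  shows "card (word_support \<alpha>) = gm_weight K \<alpha>"
proof -
  have "{j. j < length \<alpha> \<and> \<alpha> ! j \<noteq> GM_I} = {j. j < length \<alpha> \<and> gm_matrix K (\<alpha> ! j) \<noteq> 1\<^sub>m K}"
    using gm_matrix_eq_one_iff[OF assms(1) gm_words_nth[OF assms(2)]] assms(2)
    by (auto simp: gm_words_def)
  moreover have "inj_on (\<lambda>j. (j, \<alpha> ! j)) {j. j < length \<alpha> \<and> \<alpha> ! j \<noteq> GM_I}" by (auto simp: inj_on_def)
  ultimately show ?thesis by (simp add: word_support_def gm_weight_def card_image)
qed

lemma op_norm_nonneg: "op_norm_mat A \<ge> 0"
proof -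
  have "0 \<le> l2_norm_vec (A *\<^sub>v 0\<^sub>v (dim_col A))"
    by (simp add: l2_norm_vec_def sum_nonneg)
  also have "\<dots> \<le> op_norm_mat A"
    unfolding op_norm_mat_def
    by (rule cSUP_upper[OF _ bdd_above_op_norm]) (simp add: l2_norm_vec_def)
  finally show ?thesis .
qed

text \<open>
  The coefficients of an observable are real, and up to the factors \<open>s\<^sup>k\<close> with \<open>k \<le> d\<close> they are the Fourier
  coefficients of the Boolean function \<open>x \<mapsto> tr (A \<rho>(x))\<close>, whose sup norm is at most the
  operator norm.
\<close>

lemma gm_Bohnenblust_Hille:
  assumes K: "K \<ge> 2" and d: "d \<ge> 1" and n: "n \<ge> 1" and A: "A \<in> carrier_mat (K ^ n) (K ^ n)"
    and herm: "hermitian_mat A" and deg: "gm_degree_le K n d A"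
  shows "(\<Sum>\<alpha>\<in>gm_words K n. cmod (gm_coeff K n A \<alpha>) powr (2 * real d / (real d + 1)))
         powr ((real d + 1) / (2 * real d)) \<le> state_scale K ^ d * BH_cube d * op_norm_mat A"
proof -
  define p where "p = 2 * real d / (real d + 1)"
  have p: "p > 0" "(real d + 1) / (2 * real d) = 1 / p" using d by (simp_all add: p_def)
  define s where "s = state_scale K"
  have s: "s \<ge> 1" using state_scale_ge[OF K] by (simp add: s_def)
  define c where "c = gm_coeff K n A"
  define a where "a \<alpha> = Re (c \<alpha>)" for \<alpha>
  define f where "f = word_coeffs K n a"
  let ?I = "site_vars K n"
  let ?R = "\<lambda>x \<alpha>. \<Prod>j<n. if \<alpha> ! j = GM_I then 1 else x (j, \<alpha> ! j) / state_scale K"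
  have val: "product_state_value K n (site_signs x) A = (\<Sum>\<alpha>\<in>gm_words K n. c \<alpha> * complex_of_real (?R x \<alpha>))"
    if "x \<in> signs ?I" for x
    unfolding c_def using K that gm_coeff_expansion[OF K A] by (rule product_state_value_site_signs)
  have Im_c: "Im (c \<alpha>) = 0" if "\<alpha> \<in> gm_words K n" for \<alpha>
  proof (rule word_poly_eq_0_imp_coeff_0[OF K _ that, where a = "\<lambda>\<alpha>. Im (c \<alpha>)"])
    fix x assume "x \<in> signs ?I"
    from arg_cong[OF val[OF this], of Im] show "(\<Sum>\<alpha>\<in>gm_words K n. Im (c \<alpha>) * ?R x \<alpha>) = 0"
      by (simp add: Im_sum product_state_value_hermitian[OF herm A] del: of_real_prod)
  qed
  have cmod_c: "cmod (c \<alpha>) = \<bar>a \<alpha>\<bar>" if "\<alpha> \<in> gm_words K n" for \<alpha>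
    using Im_c[OF that] by (simp add: cmod_def a_def)
  have c0: "c \<alpha> = 0" if "\<alpha> \<in> gm_words K n" "d < card (word_support \<alpha>)" for \<alpha>
    using deg that card_word_support[OF K that(1)] by (auto simp: gm_degree_le_def c_def)
  have bound: "\<bar>walsh ?I f x\<bar> \<le> op_norm_mat A" if x: "x \<in> signs ?I" for x
  proof -
    have "walsh ?I f x = Re (product_state_value K n (site_signs x) A)"
      unfolding val[OF x] f_def walsh_word_coeffs by (simp add: a_def Re_sum del: of_real_prod)
    also have "\<bar>\<dots>\<bar> \<le> cmod (product_state_value K n (site_signs x) A)"
      by (rule abs_Re_le_cmod)
    also have "\<dots> \<le> op_norm_mat A"
      using K A abs_site_signs[OF x] by (rule product_state_value_le_op_norm)
    finally show ?thesis .
  qed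
  have f0: "f S = 0" if "S \<subseteq> ?I" "d < card S" for S
    unfolding f_def word_coeffs_def by (rule sum.neutral) (use that c0 in \<open>auto simp: a_def\<close>)
  \<comment> \<open>There is at least one variable, as the constant of the cube refers to positive dimensions.\<close>
  have "(0, GM_C 1) \<in> ?I" using K n by (simp add: site_vars_def gm_indices_def)
  then have ne: "?I \<noteq> {}" by auto
  have BH: "(\<Sum>S | S \<subseteq> ?I \<and> card S \<le> d. \<bar>f S\<bar> powr p) powr (1 / p) \<le> BH_cube d * op_norm_mat A"
    using BH_cube_walsh_scaled[OF d finite_site_vars ne f0 bound op_norm_nonneg]
    unfolding p_def[symmetric] p(2) by simp
  let ?W = "{\<alpha> \<in> gm_words K n. card (word_support \<alpha>) \<le> d}"
  have "(\<Sum>\<alpha>\<in>gm_words K n. cmod (c \<alpha>) powr p) = (\<Sum>\<alpha>\<in>?W. cmod (c \<alpha>) powr p)"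
    using c0 by (intro sum.mono_neutral_right) (auto simp: finite_gm_words not_le)
  also have "\<dots> \<le> (\<Sum>\<alpha>\<in>?W. (s ^ d) powr p * \<bar>f (word_support \<alpha>)\<bar> powr p)"
  proof (rule sum_mono)
    fix \<alpha> assume \<alpha>: "\<alpha> \<in> ?W"
    define k where "k = card (word_support \<alpha>)"
    have "\<bar>a \<alpha>\<bar> = s ^ k * \<bar>f (word_support \<alpha>)\<bar>"
      using \<alpha> s word_coeffs_support[of \<alpha> K n a] by (simp add: f_def s_def k_def abs_mult)
    also have "\<dots> \<le> s ^ d * \<bar>f (word_support \<alpha>)\<bar>"
      using \<alpha> s by (intro mult_right_mono power_increasing) (auto simp: k_def)
    finally have "cmod (c \<alpha>) \<le> s ^ d * \<bar>f (word_support \<alpha>)\<bar>" using cmod_c \<alpha> by simp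
    then have "cmod (c \<alpha>) powr p \<le> (s ^ d * \<bar>f (word_support \<alpha>)\<bar>) powr p"
      using p(1) by (intro powr_mono2) auto
    then show "cmod (c \<alpha>) powr p \<le> (s ^ d) powr p * \<bar>f (word_support \<alpha>)\<bar> powr p"
      using s by (simp add: powr_mult)
  qed
  also have "\<dots> = (s ^ d) powr p * (\<Sum>S\<in>word_support ` ?W. \<bar>f S\<bar> powr p)"
  proof -
    have "inj_on word_support ?W" using inj_on_word_support by (rule inj_on_subset) auto
    then show ?thesis by (simp add: sum.reindex sum_distrib_left)
  qed
  also have "\<dots> \<le> (s ^ d) powr p * (\<Sum>S | S \<subseteq> ?I \<and> card S \<le> d. \<bar>f S\<bar> powr p)"
  proof (intro mult_left_mono sum_mono2)
    show "finite {S. S \<subseteq> ?I \<and> card S \<le> d}"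
      by (rule finite_subset[of _ "Pow ?I"]) (auto simp: finite_site_vars)
    show "word_support ` ?W \<subseteq> {S. S \<subseteq> ?I \<and> card S \<le> d}"
      using word_support_subset by blast
  qed auto
  finally have "(\<Sum>\<alpha>\<in>gm_words K n. cmod (c \<alpha>) powr p) powr (1 / p)
      \<le> ((s ^ d) powr p * (\<Sum>S | S \<subseteq> ?I \<and> card S \<le> d. \<bar>f S\<bar> powr p)) powr (1 / p)"
    using p(1) by (intro powr_mono2) (auto intro!: sum_nonneg)
  also have "\<dots> = s ^ d * (\<Sum>S | S \<subseteq> ?I \<and> card S \<le> d. \<bar>f S\<bar> powr p) powr (1 / p)"
    using s p(1) by (subst powr_mult) (auto simp: powr_powr intro!: sum_nonneg)
  also have "\<dots> \<le> s ^ d * (BH_cube d * op_norm_mat A)"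
    using s by (intro mult_left_mono BH) auto
  finally show ?thesis
    unfolding c_def s_def p_def[symmetric] p(2) by (simp add: mult.assoc)
qed

theorem theorem4:
  fixes K d :: nat
  assumes "K \<ge> 2" and "d \<ge> 1"
  shows "\<exists>C :: real. C > 0 \<and>
    (\<forall>n A. n \<ge> 1 \<longrightarrow> A \<in> carrier_mat (K ^ n) (K ^ n) \<longrightarrow> hermitian_mat A \<longrightarrow>
       gm_degree_le K n d A \<longrightarrow>
       (\<Sum>\<alpha>\<in>gm_words K n. cmod (gm_coeff K n A \<alpha>) powr (2 * real d / (real d + 1)))
         powr ((real d + 1) / (2 * real d)) \<le> C * op_norm_mat A) \<and>
    C \<le> (3 / 2 * ((real K)\<^sup>2 - real K)) ^ d * BH_cube d"
proof (intro exI conjI allI impI)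
  show "state_scale K ^ d * BH_cube d > 0"
    using state_scale_ge[OF assms(1)] BH_cube_ge_1[OF assms(2)] by simp
  show "state_scale K ^ d * BH_cube d \<le> (3 / 2 * ((real K)\<^sup>2 - real K)) ^ d * BH_cube d"
    by (simp add: state_scale_def)
qed (rule gm_Bohnenblust_Hille[OF assms])

end
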